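(* Let $d\ge 1$ and let $\mathcal C=(\mathcal C_s)_{s\ge 1}$ be an (abstract) operator system on $\mathbb C^d$ with order unit $u\in\mathcal C_1\subseteq\mathbb R^d$, and let $r\ge 1$ be an integer. Then $\mathcal C$ is $r$-dimensional realizable if and only if the following holds: for any integers $n,s_1,\ldots,s_n\ge 1$ and any $A^{(i)}\in\partial\mathcal C_{s_i}$ ($i=1,\ldots,n$), there exist matrices $0\neq V_i\in\mathbb M_{s_i,r}(\mathbb C)$ ($i=1,\dots,n$) with $$\sum_{i=1}^n V_i^*A^{(i)}V_i\in\partial^{\rm ess}\mathcal C_r .$$
   Context: $\mathbb M_{s,t}(\mathbb C)$ is the space of complex $s\times t$ matrices, and ${\rm Her}_s(\mathbb C)$ is the real vector space of Hermitian $s\times s$ matrices. For $A=(A_1,\ldots,A_d)\in{\rm Her}_s(\mathbb C)^d$ and $V\in\mathbb M_{s,t}(\mathbb C)$ put $V^*AV:=(V^*A_1V,\ldots,V^*A_dV)\in{\rm Her}_t(\mathbb C)^d$. For $u\in\mathbb R^d$ and $P\in{\rm Her}_s(\mathbb C)$ put $u\otimes P:=(u_1P,\ldots,u_dP)$. Positive semidefiniteness is denoted $\geqslant 0$. An (abstract) operator system $\mathcal C$ on $\mathbb C^d$ consists of a closed, salient (i.e. $\mathcal C_s\cap(-\mathcal C_s)=\{0\}$) convex cone $\mathcal C_s\subseteq{\rm Her}_s(\mathbb C)^d$ for each $s\ge1$, such that $A\in\mathcal C_s$, $V\in\mathbb M_{s,t}(\mathbb C)$ imply $V^*AV\in\mathcal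 C_t$, together with a fixed $u\in\mathcal C_1\subseteq\mathbb R^d$ (the order unit) such that $u\otimes I_s$ is an interior point of $\mathcal C_s$ for every $s\ge 1$. $\mathcal C$ is $r$-dimensional realizable if there are $T_1,\ldots,T_d\in{\rm Her}_r(\mathbb C)$ with $\sum_i u_iT_i=I_r$ such that for all $s\ge1$ and $A\in{\rm Her}_s(\mathbb C)^d$: $A\in\mathcal C_s\Leftrightarrow T_1\otimes A_1+\cdots+T_d\otimes A_d\geqslant 0$ (Kronecker products). $\partial\mathcal C_s$ is the topological boundary of $\mathcal C_s$ in ${\rm Her}_s(\mathbb C)^d$. $\mathcal C_s^\vee$ is the dual cone of all $\mathbb R$-linear functionals $\varphi:{\rm Her}_s(\mathbb C)^d\to\mathbb R$ that are nonnegative on $\mathcal C_s$. The essential boundary is $$\partial^{\rm ess}\mathcal C_s:=\{A\in\mathcal C_s\mid \exists\,\varphi\in\mathcal C_s^\vee:\ \varphi(u\otimes vv^* )>0\text{ for all }v\in\mathbb C^s\setminus\{0\},\ \varphi(A)=0\}.$$ *)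

theory Defs
  imports
    "HOL-Analysis.Function_Topology"
    "Jordan_Normal_Form.Schur_Decomposition"
begin

text \<open>
  Matrix sizes vary inside the definitions, so matrices are those of
  \<open>Jordan_Normal_Form\<close>. A \<open>d\<close>-tuple of matrices is a function on a finite index
  type \<open>'d\<close> with \<open>CARD('d) = d\<close>; the order unit in \<open>\<real>\<^sup>d\<close> is a function \<open>'d \<Rightarrow> real\<close>.
\<close>

type_synonym 'd mtuple = "'d \<Rightarrow> complex mat"

definition hermitian_mat :: "nat \<Rightarrow> complex mat \<Rightarrow> bool" where
  "hermitian_mat s M \<longleftrightarrow> M \<in> carrier_mat s s \<and> mat_adjoint M = M"

definition Her :: "nat \<Rightarrow> 'd mtuple set" where
  "Her s = {A. \<forall>k. hermitian_mat s (A k)}"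

definition psd_mat :: "nat \<Rightarrow> complex mat \<Rightarrow> bool" where
  "psd_mat s M \<longleftrightarrow> hermitian_mat s M \<and> (\<forall>v\<in>carrier_vec s. 0 \<le> (M *\<^sub>v v) \<bullet>c v)"

definition kronecker :: "complex mat \<Rightarrow> complex mat \<Rightarrow> complex mat" where
  "kronecker A B = mat (dim_row A * dim_row B) (dim_col A * dim_col B)
     (\<lambda>(i, j). A $$ (i div dim_row B, j div dim_col B) * B $$ (i mod dim_row B, j mod dim_col B))"

text \<open>Matrices of varying size form no additive monoid type, hence an explicit finite sum of
  \<open>m \<times> n\<close> matrices.\<close>

definition msum :: "nat \<Rightarrow> nat \<Rightarrow> ('i \<Rightarrow> complex mat) \<Rightarrow> 'i set \<Rightarrow> complex mat" where
  "msum m n f I = mat m n (\<lambda>(a, b). \<Sum>i\<in>I. f i $$ (a, b))"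

definition tplus :: "'d mtuple \<Rightarrow> 'd mtuple \<Rightarrow> 'd mtuple" where
  "tplus A B = (\<lambda>k. A k + B k)"

definition tscale :: "real \<Rightarrow> 'd mtuple \<Rightarrow> 'd mtuple" where
  "tscale c A = (\<lambda>k. complex_of_real c \<cdot>\<^sub>m A k)"

text \<open>\<open>V\<^sup>* A V\<close>\<close>
definition tcompress :: "complex mat \<Rightarrow> 'd mtuple \<Rightarrow> 'd mtuple" where
  "tcompress V A = (\<lambda>k. mat_adjoint V * A k * V)"

text \<open>\<open>u \<otimes> P\<close>\<close>
definition utensor :: "('d \<Rightarrow> real) \<Rightarrow> complex mat \<Rightarrow> 'd mtuple" where
  "utensor u P = (\<lambda>k. complex_of_real (u k) \<cdot>\<^sub>m P)"

text \<open>\<open>v v\<^sup>*\<close>\<close>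
definition outer :: "complex vec \<Rightarrow> complex mat" where
  "outer v = mat (dim_vec v) (dim_vec v) (\<lambda>(i, j). v $ i * cnj (v $ j))"

text \<open>The Euclidean topology of \<open>Her\<^sub>s(\<complex>)\<^sup>d\<close>, pulled back along the coordinate embedding into
  the (product-topologized) space of entry functions. Entries with index out of range are
  unspecified in \<open>Jordan_Normal_Form\<close>, so they are set to \<open>0\<close> here.\<close>

definition entries :: "nat \<Rightarrow> 'd mtuple \<Rightarrow> 'd \<Rightarrow> nat \<Rightarrow> nat \<Rightarrow> complex" where
  "entries s A = (\<lambda>k i j. if i < s \<and> j < s then A k $$ (i, j) else 0)"

definition Her_top :: "nat \<Rightarrow> 'd mtuple topology" where
  "Her_top s = pullback_topology (Her s) (entries s) euclidean"

lemma topspace_Her_top [simp]: "topspace (Her_top s) = Her s"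
  by (simp add: Her_top_def topspace_pullback_topology)

text \<open>The cones are indexed by all naturals, but \<open>C 0\<close> is unconstrained and never used.\<close>

locale operator_system =
  fixes C :: "nat \<Rightarrow> ('d::finite) mtuple set"
    and u :: "'d \<Rightarrow> real"
  assumes subset_Her: "s \<ge> 1 \<Longrightarrow> C s \<subseteq> Her s"
    and closed: "s \<ge> 1 \<Longrightarrow> closedin (Her_top s) (C s)"
    and add_closed: "s \<ge> 1 \<Longrightarrow> A \<in> C s \<Longrightarrow> B \<in> C s \<Longrightarrow> tplus A B \<in> C s"
    and scale_closed: "s \<ge> 1 \<Longrightarrow> A \<in> C s \<Longrightarrow> c \<ge> 0 \<Longrightarrow> tscale c A \<in> C s"
    and salient: "s \<ge> 1 \<Longrightarrow> C s \<inter> tscale (- 1) ` C s = {\<lambda>k. 0\<^sub>m s s}"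
    and compress_closed: "s \<ge> 1 \<Longrightarrow> t \<ge> 1 \<Longrightarrow> A \<in> C s \<Longrightarrow> V \<in> carrier_mat s t \<Longrightarrow>
      tcompress V A \<in> C t"
    and unit_mem: "utensor u (1\<^sub>m 1) \<in> C 1"
    and unit_interior: "s \<ge> 1 \<Longrightarrow> utensor u (1\<^sub>m s) \<in> Her_top s interior_of C s"

definition realizable ::
  "nat \<Rightarrow> (nat \<Rightarrow> ('d::finite) mtuple set) \<Rightarrow> ('d \<Rightarrow> real) \<Rightarrow> bool" where
  "realizable r C u \<longleftrightarrow>
    (\<exists>T \<in> Her r.
       msum r r (\<lambda>k. complex_of_real (u k) \<cdot>\<^sub>m T k) UNIV = 1\<^sub>m r \<and>
       (\<forall>s\<ge>1. \<forall>A \<in> Her s.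
          A \<in> C s \<longleftrightarrow>
          psd_mat (r * s) (msum (r * s) (r * s) (\<lambda>k. kronecker (T k) (A k)) UNIV)))"

text \<open>A functional is a total function; only its values on \<open>Her s\<close> matter.\<close>

definition linear_on_Her :: "nat \<Rightarrow> ('d mtuple \<Rightarrow> real) \<Rightarrow> bool" where
  "linear_on_Her s \<phi> \<longleftrightarrow>
    (\<forall>A \<in> Her s. \<forall>B \<in> Her s. \<phi> (tplus A B) = \<phi> A + \<phi> B) \<and>
    (\<forall>A \<in> Her s. \<forall>c. \<phi> (tscale c A) = c * \<phi> A)"

definition dual_cone :: "nat \<Rightarrow> 'd mtuple set \<Rightarrow> ('d mtuple \<Rightarrow> real) set" where
  "dual_cone s K = {\<phi>. linear_on_Her s \<phi> \<and> (\<forall>A \<in> K. 0 \<le> \<phi> A)}"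

definition ess_boundary ::
  "(nat \<Rightarrow> 'd mtuple set) \<Rightarrow> ('d \<Rightarrow> real) \<Rightarrow> nat \<Rightarrow> 'd mtuple set" where
  "ess_boundary C u s =
    {A \<in> C s. \<exists>\<phi> \<in> dual_cone s (C s).
       (\<forall>v \<in> carrier_vec s - {0\<^sub>v s}. 0 < \<phi> (utensor u (outer v))) \<and> \<phi> A = 0}"

end

theory Submission
  imports Defs "HOL-Analysis.Elementary_Metric_Spaces"
begin

text \<open>
  A Hermitian tuple \<open>T\<close> of size \<open>r\<close> is identified with the functional
  \<open>X \<mapsto> \<Sum>\<^sub>k \<Sum>\<^sub>a\<^sub>b T\<^sub>k(a,b) X\<^sub>k(a,b)\<close> (the pairing) on tuples of size \<open>r\<close>. Reading a vector
  of \<open>\<complex>\<^sup>r \<otimes> \<complex>\<^sup>s\<close> as an \<open>s \<times> r\<close> matrix \<open>V\<close>, the quadratic form of \<open>\<Sum>\<^sub>k T\<^sub>k \<otimes> A\<^sub>k\<close> at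
  \<open>V\<close> is the pairing of \<open>T\<close> with \<open>V\<^sup>* A V\<close>. If \<open>T\<close> realizes \<open>C\<close>, then for a boundary point \<open>A\<close>
  this form is singular, and the kernel vectors \<open>V\<^sub>i\<close> together with the pairing functional of \<open>T\<close>
  exhibit the required point of the essential boundary.

  Conversely, a functional witnessing the essential boundary is the pairing with some \<open>T\<close> whose
  \<open>\<Sum>\<^sub>k u\<^sub>k T\<^sub>k\<close> is positive definite; after a congruence this sum is the identity, and \<open>T\<close> is
  singular at each of the given boundary points. The normalized tuples that are nonnegative on
  \<open>C\<^sub>r\<close> form a compact set, so by the finite intersection property one \<open>T\<close> is singular at all
  boundary points of all levels at once. Such a \<open>T\<close> realizes \<open>C\<close>: a point \<open>A\<close> outside \<open>C\<^sub>s\<close> has a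
  boundary point \<open>A + t (u \<otimes> I)\<close> with \<open>t > 0\<close>, hence the form of \<open>A\<close> takes the value \<open>-t\<close>.
\<close>

subsection \<open>Compressions, the pairing and Kronecker sums\<close>

lemma index_mat_adjoint:
  assumes "i < dim_col A" "j < dim_row A"
  shows "mat_adjoint (A :: complex mat) $$ (i, j) = cnj (A $$ (j, i))"
  using assms by (simp add: mat_adjoint_def mat_of_rows_def)

lemma carrier_mat_adjoint [simp]:
  "mat_adjoint (A :: complex mat) \<in> carrier_mat (dim_col A) (dim_row A)"
  unfolding mat_adjoint_def by (intro carrier_matI) auto

lemma dim_mat_adjoint [simp]:
  "dim_row (mat_adjoint (A :: complex mat)) = dim_col A"
  "dim_col (mat_adjoint (A :: complex mat)) = dim_row A"
  using carrier_mat_adjoint[of A] by blast+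

lemma hermitian_mat_iff:
  "hermitian_mat s M \<longleftrightarrow> M \<in> carrier_mat s s \<and> (\<forall>i<s. \<forall>j<s. M $$ (i, j) = cnj (M $$ (j, i)))"
proof (cases "M \<in> carrier_mat s s")
  case True
  then have "mat_adjoint M = M \<longleftrightarrow> (\<forall>i<s. \<forall>j<s. cnj (M $$ (j, i)) = M $$ (i, j))"
    using index_mat_adjoint[of _ M]
    by (subst mat_eq_iff) (simp add: carrier_matD[OF True])
  then show ?thesis
    using True by (simp add: hermitian_mat_def) metis
qed (simp add: hermitian_mat_def)

lemma hermitian_mat_cnj:
  "hermitian_mat s M \<Longrightarrow> i < s \<Longrightarrow> j < s \<Longrightarrow> cnj (M $$ (i, j)) = M $$ (j, i)"
  unfolding hermitian_mat_iff by (rule sym) blast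

lemma Her_carrier: "A \<in> Her s \<Longrightarrow> A k \<in> carrier_mat s s"
  by (simp add: Her_def hermitian_mat_iff)

lemma Her_dim: "A \<in> Her s \<Longrightarrow> dim_row (A k) = s" "A \<in> Her s \<Longrightarrow> dim_col (A k) = s"
  by (auto dest: Her_carrier[of A s k])

lemma Her_cnj: "A \<in> Her s \<Longrightarrow> i < s \<Longrightarrow> j < s \<Longrightarrow> cnj (A k $$ (i, j)) = A k $$ (j, i)"
  using hermitian_mat_cnj[of s "A k"] by (simp add: Her_def)

lemma HerI:
  assumes "\<And>k. A k \<in> carrier_mat s s"
    and "\<And>k i j. i < s \<Longrightarrow> j < s \<Longrightarrow> A k $$ (i, j) = cnj (A k $$ (j, i))"
  shows "A \<in> Her s"
  using assms unfolding Her_def hermitian_mat_iff by blast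

lemma Her_eqI:
  assumes "A \<in> Her s" "B \<in> Her s"
    and "\<And>k i j. i < s \<Longrightarrow> j < s \<Longrightarrow> A k $$ (i, j) = B k $$ (i, j)"
  shows "A = B"
  using assms by (intro ext eq_matI) (auto simp: Her_dim)

lemma index_tplus:
  "A \<in> Her s \<Longrightarrow> B \<in> Her s \<Longrightarrow> i < s \<Longrightarrow> j < s \<Longrightarrow>
    tplus A B k $$ (i, j) = A k $$ (i, j) + B k $$ (i, j)"
  by (simp add: tplus_def Her_dim)

lemma index_tscale:
  "A \<in> Her s \<Longrightarrow> i < s \<Longrightarrow> j < s \<Longrightarrow> tscale c A k $$ (i, j) = of_real c * A k $$ (i, j)"
  by (simp add: tscale_def Her_dim)

lemma tplus_Her: "A \<in> Her s \<Longrightarrow> B \<in> Her s \<Longrightarrow> tplus A B \<in> Her s"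
  by (rule HerI) (auto simp: index_tplus Her_cnj, auto simp: tplus_def Her_carrier)

lemma tscale_Her: "A \<in> Her s \<Longrightarrow> tscale c A \<in> Her s"
  by (rule HerI) (auto simp: index_tscale Her_cnj, auto simp: tscale_def Her_carrier)

lemma zero_Her: "(\<lambda>k. 0\<^sub>m s s) \<in> Her s"
  by (rule HerI) auto

lemma index_utensor:
  "P \<in> carrier_mat s s \<Longrightarrow> i < s \<Longrightarrow> j < s \<Longrightarrow> utensor u P k $$ (i, j) = of_real (u k) * P $$ (i, j)"
  by (auto simp: utensor_def)

lemma utensor_Her:
  assumes "hermitian_mat s P"
  shows "utensor u P \<in> Her s"
proof (rule HerI)
  have P: "P \<in> carrier_mat s s"
    using assms by (simp add: hermitian_mat_def)
  then show "utensor u P k \<in> carrier_mat s s" for k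
    by (simp add: utensor_def)
  show "utensor u P k $$ (i, j) = cnj (utensor u P k $$ (j, i))" if "i < s" "j < s" for k i j
    using P that assms by (simp add: index_utensor hermitian_mat_cnj)
qed

lemma utensor_one_Her: "utensor u (1\<^sub>m s) \<in> Her s"
  by (rule utensor_Her) (auto simp: hermitian_mat_iff)

lemma outer_hermitian: "v \<in> carrier_vec s \<Longrightarrow> hermitian_mat s (outer v)"
  by (auto simp: hermitian_mat_iff outer_def mult.commute)

lemma index_tcompress:
  assumes "V \<in> carrier_mat s t" "A k \<in> carrier_mat s s" "a < t" "b < t"
  shows "tcompress V A k $$ (a, b) = (\<Sum>i<s. \<Sum>j<s. cnj (V $$ (i, a)) * A k $$ (i, j) * V $$ (j, b))"
proof -
  have "tcompress V A k $$ (a, b)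
      = (\<Sum>j<s. (\<Sum>i<s. cnj (V $$ (i, a)) * A k $$ (i, j)) * V $$ (j, b))"
    using assms by (auto simp: tcompress_def scalar_prod_def index_mat_adjoint atLeast0LessThan intro!: sum.cong)
  then show ?thesis
    by (simp add: sum_distrib_right) (rule sum.swap)
qed

lemma tcompress_carrier:
  "V \<in> carrier_mat s t \<Longrightarrow> tcompress V A k \<in> carrier_mat t t"
  unfolding tcompress_def by (intro carrier_matI) auto

lemma tcompress_Her:
  assumes "V \<in> carrier_mat s t" "A \<in> Her s"
  shows "tcompress V A \<in> Her t"
proof (rule HerI)
  fix k a b assume "a < t" "b < t"
  then show "tcompress V A k $$ (a, b) = cnj (tcompress V A k $$ (b, a))"
    using assms
    by (simp add: index_tcompress Her_carrier Her_cnj mult_ac) (subst sum.swap, simp add: Her_cnj mult_ac)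
qed (use assms in \<open>simp add: tcompress_carrier\<close>)

text \<open>This later absorbs a congruence of the functional into the compressing matrices.\<close>

lemma tcompress_tcompress:
  assumes "V \<in> carrier_mat s t" "R \<in> carrier_mat t q" "A \<in> Her s"
  shows "tcompress R (tcompress V A) = tcompress (V * R) A"
proof -
  have adj: "mat_adjoint (V * R) = mat_adjoint R * mat_adjoint V"
    using assms by (intro eq_matI)
      (auto simp: index_mat_adjoint scalar_prod_def atLeast0LessThan mult.commute intro!: sum.cong)
  show ?thesis
  proof
    fix k
    have c: "A k \<in> carrier_mat s s" "mat_adjoint V \<in> carrier_mat t s" "mat_adjoint R \<in> carrier_mat q t"
      using assms carrier_mat_adjoint[of V] carrier_mat_adjoint[of R] by (auto simp: Her_carrier)
    then show "tcompress R (tcompress V A) k = tcompress (V * R) A k"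
      using assms unfolding tcompress_def adj
      by (smt (verit) assoc_mult_mat mult_carrier_mat)
  qed
qed

lemma tcompress_smult:
  assumes "V \<in> carrier_mat s t" "A \<in> Her s"
  shows "tcompress (of_real c \<cdot>\<^sub>m V) A = tscale (c^2) (tcompress V A)"
proof (rule Her_eqI)
  show "tcompress (of_real c \<cdot>\<^sub>m V) A \<in> Her t" "tscale (c^2) (tcompress V A) \<in> Her t"
    using assms by (auto intro!: tcompress_Her tscale_Her)
  fix k i j assume "i < t" "j < t"
  then show "tcompress (of_real c \<cdot>\<^sub>m V) A k $$ (i, j) = tscale (c^2) (tcompress V A) k $$ (i, j)"
    using assms by (simp add: index_tscale[OF tcompress_Her] index_tcompress[of _ s t] Her_carrier
        sum_distrib_left power2_eq_square mult_ac)
qed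

text \<open>Sum of the traces of the transpose of \<open>T k\<close> times \<open>X k\<close>. The
  transpose lets \<open>T\<close> enter \<open>kronecker_sum_form\<close> unchanged. Values are
  complex, but real on Hermitian tuples.\<close>

definition pairing :: "nat \<Rightarrow> 'd::finite mtuple \<Rightarrow> 'd mtuple \<Rightarrow> complex" where
  "pairing r T X = (\<Sum>k\<in>UNIV. \<Sum>a<r. \<Sum>b<r. T k $$ (a, b) * X k $$ (a, b))"

lemma cnj_pairing:
  assumes "T \<in> Her r" "X \<in> Her r"
  shows "cnj (pairing r T X) = pairing r T X"
proof -
  have "cnj (pairing r T X) = (\<Sum>k\<in>UNIV. \<Sum>a<r. \<Sum>b<r. T k $$ (b, a) * X k $$ (b, a))"
    using assms by (simp add: pairing_def Her_cnj)
  also have "\<dots> = pairing r T X"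
    unfolding pairing_def by (intro sum.cong refl sum.swap)
  finally show ?thesis .
qed

lemma pairing_real: "T \<in> Her r \<Longrightarrow> X \<in> Her r \<Longrightarrow> Im (pairing r T X) = 0"
  using cnj_pairing[of T r X] by (simp add: complex_eq_iff)

lemma pairing_tplus:
  "A \<in> Her r \<Longrightarrow> B \<in> Her r \<Longrightarrow> pairing r T (tplus A B) = pairing r T A + pairing r T B"
  by (simp add: pairing_def index_tplus sum.distrib distrib_left)

lemma pairing_tscale: "A \<in> Her r \<Longrightarrow> pairing r T (tscale c A) = of_real c * pairing r T A"
  by (simp add: pairing_def index_tscale sum_distrib_left mult_ac)

lemma pairing_msum:
  assumes "\<And>i k. i \<in> I \<Longrightarrow> X i k \<in> carrier_mat r r"
  shows "pairing r T (\<lambda>k. msum r r (\<lambda>i. X i k) I) = (\<Sum>i\<in>I. pairing r T (X i))"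
proof -
  have "pairing r T (\<lambda>k. msum r r (\<lambda>i. X i k) I)
    = (\<Sum>k\<in>UNIV. \<Sum>a<r. \<Sum>b<r. \<Sum>i\<in>I. T k $$ (a, b) * X i k $$ (a, b))"
    by (simp add: pairing_def msum_def sum_distrib_left)
  also have "\<dots> = (\<Sum>i\<in>I. pairing r T (X i))"
    unfolding pairing_def
    by (simp add: sum.swap[of _ I])
  finally show ?thesis .
qed

lemma pairing_tcompress:
  assumes "V \<in> carrier_mat s r" "A \<in> Her s"
  shows "pairing r T (tcompress V A) = (\<Sum>k\<in>UNIV. \<Sum>a<r. \<Sum>b<r. \<Sum>i<s. \<Sum>j<s.
    T k $$ (a, b) * (cnj (V $$ (i, a)) * A k $$ (i, j) * V $$ (j, b)))"
  using assms by (simp add: pairing_def index_tcompress Her_carrier sum_distrib_left)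

text \<open>On tuples of this kind only the single matrix with entries sum of
  \<open>u k * T k\<close> matters. Strict positivity and normalization of \<open>T\<close> are
  therefore conditions on that matrix alone.\<close>

lemma pairing_utensor:
  assumes "P \<in> carrier_mat r r"
  shows "pairing r T (utensor u P)
    = (\<Sum>a<r. \<Sum>b<r. (\<Sum>k\<in>UNIV. of_real (u k) * T k $$ (a, b)) * P $$ (a, b))"
proof -
  have "pairing r T (utensor u P)
     = (\<Sum>k\<in>UNIV. \<Sum>a<r. \<Sum>b<r. of_real (u k) * T k $$ (a, b) * P $$ (a, b))"
    using assms by (simp add: pairing_def index_utensor mult_ac)
  also have "\<dots> = (\<Sum>a<r. \<Sum>b<r. \<Sum>k\<in>UNIV. of_real (u k) * T k $$ (a, b) * P $$ (a, b))"
    by (subst sum.swap) (intro sum.cong refl sum.swap)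
  finally show ?thesis by (simp add: sum_distrib_right)
qed

section \<open>Quadratic forms of Kronecker sums\<close>

lemma sum_lessThan_mult:
  fixes f :: "nat \<Rightarrow> nat \<Rightarrow> 'a::comm_monoid_add"
  shows "(\<Sum>i<r * s. f (i div s) (i mod s)) = (\<Sum>a<r. \<Sum>p<s. f a p)"
proof -
  \<comment> \<open>The range is cut into \<open>r\<close> consecutive blocks of length
    \<open>s\<close>; on block \<open>a\<close> the quotient is \<open>a\<close> and the remainder
    runs through all \<open>p < s\<close>.\<close>
  have "(\<Sum>i<r * s. f (i div s) (i mod s)) = (\<Sum>a<r. \<Sum>i=a*s..<a*s+s. f (i div s) (i mod s))"
    by (rule sum.nat_group[symmetric])
  also have "\<dots> = (\<Sum>a<r. \<Sum>p<s. f a p)"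
  proof (rule sum.cong[OF refl])
    fix a
    have "(\<Sum>i=a*s..<a*s+s. f (i div s) (i mod s)) = (\<Sum>p=0..<s. f ((p + a*s) div s) ((p + a*s) mod s))"
      using sum.shift_bounds_nat_ivl[of "\<lambda>i. f (i div s) (i mod s)" 0 "a*s" s] by (simp add: add.commute)
    then show "(\<Sum>i=a*s..<a*s+s. f (i div s) (i mod s)) = (\<Sum>p<s. f a p)"
      by (simp add: atLeast0LessThan)
  qed
  finally show ?thesis .
qed

lemma div_less_of_less_mult: "i < r * s \<Longrightarrow> i div s < r" for i r s :: nat
  by (simp add: less_mult_imp_div_less)

lemma mod_less_of_less_mult: "i < r * s \<Longrightarrow> i mod s < s" for i r s :: nat
  by (cases "s = 0") auto

lemma index_kronecker_sum:
  assumes "T \<in> Her r" "A \<in> Her s" "i < r * s" "j < r * s"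
  shows "msum (r * s) (r * s) (\<lambda>k. kronecker (T k) (A k)) UNIV $$ (i, j)
    = (\<Sum>k\<in>UNIV. T k $$ (i div s, j div s) * A k $$ (i mod s, j mod s))"
  using assms by (simp add: msum_def kronecker_def Her_dim)

lemma hermitian_kronecker_sum:
  assumes "T \<in> Her r" "A \<in> Her s"
  shows "hermitian_mat (r * s) (msum (r * s) (r * s) (\<lambda>k. kronecker (T k) (A k)) UNIV)"
  using assms unfolding hermitian_mat_iff
  by (auto simp: index_kronecker_sum Her_cnj div_less_of_less_mult mod_less_of_less_mult) (simp add: msum_def)

text \<open>Here \<open>v\<close> stacks the columns of \<open>V\<close>. Splitting both vector
  indices by division with remainder turns the quadratic form into the sum that defines the
  pairing.\<close>

lemma kronecker_sum_form:
  assumes "T \<in> Her r" "A \<in> Her s" "v \<in> carrier_vec (r * s)" "V \<in> carrier_mat s r"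
    and vV: "\<And>i. i < r * s \<Longrightarrow> v $ i = V $$ (i mod s, i div s)"
  shows "(msum (r * s) (r * s) (\<lambda>k. kronecker (T k) (A k)) UNIV *\<^sub>v v) \<bullet>c v
    = pairing r T (tcompress V A)"
proof -
  let ?K = "msum (r * s) (r * s) (\<lambda>k. kronecker (T k) (A k)) UNIV"
  let ?f = "\<lambda>k a p b q. T k $$ (a, b) * (cnj (V $$ (p, a)) * A k $$ (p, q) * V $$ (q, b))"
  have K: "?K \<in> carrier_mat (r * s) (r * s)" by (simp add: msum_def)
  have "(?K *\<^sub>v v) \<bullet>c v = (\<Sum>i<r*s. (\<Sum>j<r*s. ?K $$ (i, j) * v $ j) * cnj (v $ i))"
    using assms K by (simp add: scalar_prod_def atLeast0LessThan)
  also have "\<dots> = (\<Sum>i<r*s. \<Sum>j<r*s. \<Sum>k\<in>UNIV. ?f k (i div s) (i mod s) (j div s) (j mod s))"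
    unfolding sum_distrib_right
    by (intro sum.cong refl) (simp add: index_kronecker_sum[OF assms(1,2)] vV sum_distrib_right sum_distrib_left mult_ac)
  also have "\<dots> = (\<Sum>k\<in>UNIV. \<Sum>i<r*s. \<Sum>j<r*s. ?f k (i div s) (i mod s) (j div s) (j mod s))"
    by (subst sum.swap[of _ UNIV], intro sum.cong refl sum.swap)
  also have "\<dots> = (\<Sum>k\<in>UNIV. \<Sum>a<r. \<Sum>p<s. \<Sum>b<r. \<Sum>q<s. ?f k a p b q)"
    by (simp add: sum_lessThan_mult[where f = "\<lambda>b q. ?f _ _ _ b q"]
        sum_lessThan_mult[where f = "\<lambda>a p. \<Sum>b<r. \<Sum>q<s. ?f _ a p b q"])
  also have "\<dots> = (\<Sum>k\<in>UNIV. \<Sum>a<r. \<Sum>b<r. \<Sum>p<s. \<Sum>q<s. ?f k a p b q)"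
    by (intro sum.cong refl sum.swap)
  also have "\<dots> = pairing r T (tcompress V A)"
    using assms by (simp add: pairing_tcompress)
  finally show ?thesis .
qed

text \<open>Stacking columns is a bijection between \<open>s\<close> by \<open>r\<close> matrices
  and vectors of length \<open>r * s\<close>, so both sides test the same values. Hermitian symmetry
  of the Kronecker sum is automatic.\<close>

lemma psd_kronecker_sum_iff:
  assumes "T \<in> Her r" "A \<in> Her s"
  shows "psd_mat (r * s) (msum (r * s) (r * s) (\<lambda>k. kronecker (T k) (A k)) UNIV)
    \<longleftrightarrow> (\<forall>V\<in>carrier_mat s r. 0 \<le> Re (pairing r T (tcompress V A)))" (is "psd_mat _ ?K \<longleftrightarrow> _")
proof -
  have nonneg: "0 \<le> pairing r T (tcompress V A) \<longleftrightarrow> 0 \<le> Re (pairing r T (tcompress V A))"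
    if "V \<in> carrier_mat s r" for V
    using pairing_real[OF assms(1) tcompress_Her[OF that assms(2)]] by (simp add: less_eq_complex_def)
  have "(\<forall>v\<in>carrier_vec (r * s). 0 \<le> (?K *\<^sub>v v) \<bullet>c v)
    \<longleftrightarrow> (\<forall>V\<in>carrier_mat s r. 0 \<le> pairing r T (tcompress V A))" (is "?L \<longleftrightarrow> ?R")
  proof
    assume L: ?L
    show ?R
    proof
      fix V :: "complex mat" assume V: "V \<in> carrier_mat s r"
      let ?v = "vec (r * s) (\<lambda>i. V $$ (i mod s, i div s)) :: complex vec"
      have "(?K *\<^sub>v ?v) \<bullet>c ?v = pairing r T (tcompress V A)"
        using assms V by (intro kronecker_sum_form) auto
      then show "0 \<le> pairing r T (tcompress V A)"
        using bspec[OF L, of ?v] by simp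
    qed
  next
    assume R: ?R
    show ?L
    proof
      fix v :: "complex vec" assume v: "v \<in> carrier_vec (r * s)"
      \<comment> \<open>Unstacking: column \<open>a\<close> is the block of \<open>v\<close> that
        starts at \<open>a * s\<close>.\<close>
      let ?V = "mat s r (\<lambda>(p, a). v $ (a * s + p))"
      have "(?K *\<^sub>v v) \<bullet>c v = pairing r T (tcompress ?V A)"
        using assms v by (intro kronecker_sum_form)
          (auto simp: div_less_of_less_mult mod_less_of_less_mult)
      then show "0 \<le> (?K *\<^sub>v v) \<bullet>c v"
        using bspec[OF R, of ?V] by simp
    qed
  qed
  then show ?thesis
    unfolding psd_mat_def using hermitian_kronecker_sum[OF assms] nonneg by auto
qed

subsection \<open>The boundary of an operator system\<close>

text \<open>The topology is pulled back from a product along \<open>entries\<close>, so continuity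
  is checked coordinatewise; coordinates out of range are constantly 0.\<close>

lemma continuous_map_into_Her_top:
  assumes "\<And>x. x \<in> topspace X \<Longrightarrow> f x \<in> Her s"
    and "\<And>k i j. i < s \<Longrightarrow> j < s \<Longrightarrow> continuous_map X euclidean (\<lambda>x. f x k $$ (i, j))"
  shows "continuous_map X (Her_top s) f"
proof -
  have "continuous_map X euclidean (\<lambda>x. entries s (f x) k i j)" for k i j
    using assms(2)[of i j k] by (cases "i < s \<and> j < s") (auto simp: entries_def)
  then have "continuous_map X euclidean (entries s \<circ> f)"
    by (simp add: euclidean_product_topology[symmetric] continuous_map_componentwise_UNIV o_def)
  then show ?thesis
    using assms(1) unfolding Her_top_def by (intro continuous_map_pullback') auto
qed

lemma continuous_map_Her_top_entry:
  assumes "i < s" "j < s"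
  shows "continuous_map (Her_top s) euclidean (\<lambda>A. A k $$ (i, j))"
proof -
  have "continuous_on UNIV (\<lambda>e :: 'a \<Rightarrow> nat \<Rightarrow> nat \<Rightarrow> complex. e k i)"
    by (rule continuous_on_product_then_coordinatewise) simp
  then have "continuous_map euclidean euclidean (\<lambda>e :: 'a \<Rightarrow> nat \<Rightarrow> nat \<Rightarrow> complex. e k i j)"
    by (simp only: continuous_map_iff_continuous2) (rule continuous_on_product_then_coordinatewise)
  then have "continuous_map (Her_top s) euclidean ((\<lambda>e. e k i j) \<circ> entries s)"
    unfolding Her_top_def by (rule continuous_map_pullback)
  then show ?thesis
    using assms by (simp add: o_def entries_def)
qed

lemma continuous_map_Her_top_affine:
  assumes "B \<in> Her s"
  shows "continuous_map (Her_top s) (Her_top s) (\<lambda>Y. tscale c (tplus Y B))"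
proof (rule continuous_map_into_Her_top)
  fix k i j assume ij: "i < s" "j < s"
  have "continuous_map euclidean euclidean (\<lambda>z :: complex. of_real c * (z + B k $$ (i, j)))"
    by (auto intro!: continuous_intros)
  from continuous_map_compose[OF continuous_map_Her_top_entry[OF ij, of k] this]
  have "continuous_map (Her_top s) euclidean (\<lambda>Y. of_real c * (Y k $$ (i, j) + B k $$ (i, j)))"
    by (simp add: o_def)
  moreover have "of_real c * (Y k $$ (i, j) + B k $$ (i, j)) = tscale c (tplus Y B) k $$ (i, j)"
    if "Y \<in> topspace (Her_top s)" for Y
    using that assms ij by (simp add: tscale_def tplus_def Her_dim)
  ultimately show "continuous_map (Her_top s) euclidean (\<lambda>Y. tscale c (tplus Y B) k $$ (i, j))"
    by (rule continuous_map_eq)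
qed (use assms in \<open>auto intro: tscale_Her tplus_Her\<close>)

lemma continuous_map_Her_top_line:
  assumes "A \<in> Her s" "X \<in> Her s"
  shows "continuous_map euclideanreal (Her_top s) (\<lambda>t. tplus A (tscale t X))"
proof (rule continuous_map_into_Her_top)
  fix k i j assume ij: "i < s" "j < s"
  have "continuous_map euclideanreal euclidean (\<lambda>t. A k $$ (i, j) + of_real t * X k $$ (i, j))"
    by (auto intro!: continuous_intros)
  then show "continuous_map euclideanreal euclidean (\<lambda>t. tplus A (tscale t X) k $$ (i, j))"
    using assms ij by (simp add: tscale_def tplus_def Her_dim)
qed (use assms in \<open>auto intro: tscale_Her tplus_Her\<close>)

section \<open>Order unit arguments in the cones\<close>

context operator_system
begin

abbreviation unit :: "nat \<Rightarrow> 'd mtuple" where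
  "unit s \<equiv> utensor u (1\<^sub>m s)"

lemma mem_Her: "s \<ge> 1 \<Longrightarrow> A \<in> C s \<Longrightarrow> A \<in> Her s"
  using subset_Her by blast

lemma unit_mem_C: "s \<ge> 1 \<Longrightarrow> unit s \<in> C s"
  using unit_interior interior_of_subset[of "Her_top s" "C s"] by blast

text \<open>The set \<open>N\<close> is the interior of the cone, dilated by
  \<open>\<epsilon>\<close> and translated by \<open>B\<close>. It is open as a preimage under the
  inverse affine map \<open>g\<close>, and it lies in the cone because the cone is closed under sums
  and dilations.\<close>

lemma tplus_unit_in_interior:
  assumes s: "s \<ge> 1" and B: "B \<in> C s" and "\<epsilon> > 0"
  shows "tplus B (tscale \<epsilon> (unit s)) \<in> Her_top s interior_of C s"
proof -
  have BH: "B \<in> Her s" using assms mem_Her by blast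
  define g where "g = (\<lambda>Y :: 'd mtuple. tscale (1 / \<epsilon>) (tplus Y (tscale (- 1) B)))"
  define N where "N = {Y \<in> topspace (Her_top s). g Y \<in> Her_top s interior_of C s}"
  have "openin (Her_top s) N"
    unfolding N_def g_def
    by (intro openin_continuous_map_preimage[OF continuous_map_Her_top_affine] tscale_Her BH
        openin_interior_of)
  moreover have "N \<subseteq> C s"
  proof
    fix Y assume Y: "Y \<in> N"
    then have YH: "Y \<in> Her s" and gY: "g Y \<in> C s"
      using interior_of_subset[of "Her_top s" "C s"] by (auto simp: N_def)
    have "Y = tplus B (tscale \<epsilon> (g Y))"
      using BH YH \<open>\<epsilon> > 0\<close> unfolding g_def
      by (intro Her_eqI[of _ s] tplus_Her tscale_Her) (auto simp: tplus_def tscale_def Her_dim field_simps)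
    then show "Y \<in> C s"
      using add_closed[OF s B scale_closed[OF s gY, of \<epsilon>]] \<open>\<epsilon> > 0\<close> by simp
  qed
  moreover have "g (tplus B (tscale \<epsilon> (unit s))) = unit s"
    using BH utensor_one_Her[of u s] \<open>\<epsilon> > 0\<close> unfolding g_def
    by (intro Her_eqI[of _ s] tplus_Her tscale_Her) (auto simp: tplus_def tscale_def Her_dim field_simps)
  then have "tplus B (tscale \<epsilon> (unit s)) \<in> N"
    using BH unit_interior[OF s] by (auto simp: N_def intro!: tplus_Her tscale_Her utensor_one_Her)
  ultimately show ?thesis
    using interior_of_maximal[of N "C s" "Her_top s"] by blast
qed

lemma interior_line:
  assumes "A \<in> Her_top s interior_of C s" "X \<in> Her s"
  obtains \<delta> where "\<delta> > 0" "\<And>t. \<bar>t\<bar> < \<delta> \<Longrightarrow> tplus A (tscale t X) \<in> C s"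
proof -
  let ?f = "\<lambda>t. tplus A (tscale t X)"
  have A: "A \<in> Her s"
    using assms(1) interior_of_subset_topspace[of "Her_top s"] by auto
  have "openin euclideanreal {t \<in> topspace euclideanreal. ?f t \<in> Her_top s interior_of C s}"
    by (intro openin_continuous_map_preimage[OF continuous_map_Her_top_line[of A s]] A assms openin_interior_of)
  then have "open {t. ?f t \<in> Her_top s interior_of C s}"
    by simp
  moreover have "?f 0 = A"
    using A assms(2) by (intro Her_eqI[of _ s] tplus_Her tscale_Her) (auto simp: tplus_def tscale_def Her_dim)
  then have "0 \<in> {t. ?f t \<in> Her_top s interior_of C s}"
    using assms(1) by simp
  ultimately obtain \<delta> where "\<delta> > 0" "ball 0 \<delta> \<subseteq> {t. ?f t \<in> Her_top s interior_of C s}"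
    by (rule openE)
  then show ?thesis
    using interior_of_subset[of "Her_top s" "C s"]
    by (intro that[of \<delta>]) (auto simp: dist_real_def subset_iff)
qed

text \<open>From the interior point \<open>unit s\<close> one may move a little in the directions
  \<open>X\<close> and \<open>-X\<close>; dilating the resulting points by the reciprocal of the
  step length gives the claim.\<close>

lemma unit_dominates:
  assumes s: "s \<ge> 1" and X: "X \<in> Her s"
  obtains c where "c > 0" "tplus (tscale c (unit s)) X \<in> C s" "tplus (tscale c (unit s)) (tscale (- 1) X) \<in> C s"
proof -
  obtain \<delta> where \<delta>: "\<delta> > 0" "\<And>t. \<bar>t\<bar> < \<delta> \<Longrightarrow> tplus (unit s) (tscale t X) \<in> C s"
    using interior_line[OF unit_interior[OF s] X] by blast
  \<comment> \<open>Half of \<open>\<delta>\<close> as step length keeps the bound strict.\<close>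
  define c where "c = 2 / \<delta>"
  have c: "c > 0" "\<bar>1 / c\<bar> < \<delta>" using \<delta>(1) by (auto simp: c_def)
  have "tplus (tscale c (unit s)) X = tscale c (tplus (unit s) (tscale (1 / c) X))"
    using utensor_one_Her[of u s] X c(1)
    by (intro Her_eqI[of _ s] tplus_Her tscale_Her) (auto simp: tplus_def tscale_def Her_dim field_simps)
  moreover have "tplus (tscale c (unit s)) (tscale (- 1) X) = tscale c (tplus (unit s) (tscale (- (1 / c)) X))"
    using utensor_one_Her[of u s] X c(1)
    by (intro Her_eqI[of _ s] tplus_Her tscale_Her) (auto simp: tplus_def tscale_def Her_dim field_simps)
  moreover have "tscale c (tplus (unit s) (tscale (1 / c) X)) \<in> C s"
    using \<delta>(2)[OF c(2)] c(1) by (intro scale_closed s) simp_all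
  moreover have "tscale c (tplus (unit s) (tscale (- (1 / c)) X)) \<in> C s"
    using \<delta>(2)[of "- (1 / c)"] c by (intro scale_closed s) simp_all
  ultimately show ?thesis
    using that[OF c(1)] by simp
qed

lemma frontier_iff:
  "s \<ge> 1 \<Longrightarrow> A \<in> Her_top s frontier_of C s \<longleftrightarrow> A \<in> C s \<and> A \<notin> Her_top s interior_of C s"
  using closed closure_of_closedin by (simp add: frontier_of_def) blast

text \<open>The witness is the least \<open>t\<close> for which the line through \<open>A\<close> in
  the direction of the unit lies in the cone. It exists because the set \<open>S\<close> of such
  parameters is nonempty, closed and bounded below.\<close>

lemma exists_unit_translate_in_frontier:
  assumes s: "s \<ge> 1" and A: "A \<in> Her s" "A \<notin> C s"
  obtains t where "t > 0" "tplus A (tscale t (unit s)) \<in> Her_top s frontier_of C s"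
proof -
  let ?f = "\<lambda>t. tplus A (tscale t (unit s))"
  define S where "S = {t. ?f t \<in> C s}"
  note I = utensor_one_Her[of u s]
  have add: "tplus (?f a) (tscale b (unit s)) = ?f (a + b)" for a b
    using A(1) I by (intro Her_eqI[of _ s] tplus_Her tscale_Her) (auto simp: tplus_def tscale_def Her_dim field_simps)
  have f0: "?f 0 = A"
    using A(1) I by (intro Her_eqI[of _ s] tplus_Her tscale_Her) (auto simp: tplus_def tscale_def Her_dim)
  have "closedin euclideanreal {t \<in> topspace euclideanreal. ?f t \<in> C s}"
    by (intro closedin_continuous_map_preimage[OF continuous_map_Her_top_line[of A s]] A I closed s)
  then have S_closed: "Topological_Spaces.closed S"
    by (simp add: S_def)
  obtain c where c: "c > 0" "tplus (tscale c (unit s)) A \<in> C s"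
    using unit_dominates[OF s A(1)] by blast
  have "tplus (tscale c (unit s)) A = ?f c"
    using A(1) I by (intro Her_eqI[of _ s] tplus_Her tscale_Her) (auto simp: tplus_def tscale_def Her_dim)
  then have ne: "S \<noteq> {}" using c by (auto simp: S_def)
  \<comment> \<open>Otherwise adding the nonnegative multiple \<open>- t\<close> of the unit would
    return to \<open>A\<close> inside the cone.\<close>
  have pos: "t > 0" if "t \<in> S" for t
  proof (rule ccontr)
    assume "\<not> t > 0"
    have "tplus (?f t) (tscale (- t) (unit s)) \<in> C s"
      by (rule add_closed[OF s _ scale_closed[OF s unit_mem_C[OF s]]])
        (use that \<open>\<not> t > 0\<close> in \<open>simp_all add: S_def\<close>)
    then show False using A(2) f0 by (simp add: add)
  qed
  then have bdd: "bdd_below S" by (intro bdd_belowI[of _ 0]) (auto intro: less_imp_le)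
  define t where "t = Inf S"
  have tS: "t \<in> S" unfolding t_def using ne bdd S_closed by (rule closed_contains_Inf)
  \<comment> \<open>At an interior point the parameter could be lowered further, against
    minimality.\<close>
  have "?f t \<notin> Her_top s interior_of C s"
  proof
    assume "?f t \<in> Her_top s interior_of C s"
    then obtain \<delta> where \<delta>: "\<delta> > 0" "\<And>b. \<bar>b\<bar> < \<delta> \<Longrightarrow> tplus (?f t) (tscale b (unit s)) \<in> C s"
      using interior_line[OF _ I] by blast
    then have "t - \<delta> / 2 \<in> S"
      using \<delta>(2)[of "- (\<delta> / 2)"] by (simp add: add S_def)
    then have "t \<le> t - \<delta> / 2" unfolding t_def using bdd by (rule cInf_lower)
    then show False using \<delta>(1) by simp
  qed
  then show ?thesis
    using tS pos s by (intro that[of t]) (auto simp: frontier_iff S_def)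
qed

text \<open>Salience prevents a nonzero tuple and its negative from both lying in the cone, so some
  Hermitian tuple is outside and can be moved to the boundary. This boundary point keeps later
  finite families nonempty.\<close>

lemma exists_frontier:
  obtains A where "A \<in> Her_top 1 frontier_of C 1"
proof -
  define X :: "'d mtuple" where "X = (\<lambda>k. 1\<^sub>m 1)"
  have XH: "X \<in> Her 1" by (rule HerI) (auto simp: X_def)
  have inv: "tscale (- 1) (tscale (- 1) X) = X"
    using XH by (intro Her_eqI[of _ 1] tscale_Her) (auto simp: tscale_def Her_dim)
  have "X \<noteq> (\<lambda>k. 0\<^sub>m 1 1)"
  proof
    assume "X = (\<lambda>k. 0\<^sub>m 1 1)"
    \<comment> \<open>Any index serves; the index type is inhabited.\<close>
    then have "X undefined $$ (0, 0) = 0" by simp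
    then show False by (simp add: X_def)
  qed
  moreover have "X = (\<lambda>k. 0\<^sub>m 1 1)" if "X \<in> C 1" "tscale (- 1) X \<in> C 1"
  proof -
    have "tscale (- 1) (tscale (- 1) X) \<in> tscale (- 1) ` C 1"
      using that(2) by (rule imageI)
    then have "X \<in> C 1 \<inter> tscale (- 1) ` C 1"
      using that(1) by (simp add: inv)
    then show ?thesis
      using salient[OF order_refl] by blast
  qed
  ultimately have "X \<notin> C 1 \<or> tscale (- 1) X \<notin> C 1" by blast
  then obtain Y where "Y \<in> Her 1" "Y \<notin> C 1" using XH tscale_Her by blast
  then show ?thesis using exists_unit_translate_in_frontier[of 1 Y] that by auto
qed

end

subsection \<open>Linear functionals as pairings\<close>

text \<open>The halves allow a sum over all ordered pairs: an off-diagonal position is met twice,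
  and for \<open>a = b\<close> the two terms add up to the real part of \<open>c\<close>.\<close>

definition herm_unit :: "nat \<Rightarrow> 'd \<Rightarrow> nat \<Rightarrow> nat \<Rightarrow> complex \<Rightarrow> 'd mtuple" where
  "herm_unit r k a b c = (\<lambda>l. mat r r (\<lambda>(i, j). if l = k then
     (if i = a then if j = b then c / 2 else 0 else 0) +
     (if i = b then if j = a then cnj c / 2 else 0 else 0) else 0))"

lemma herm_unit_Her: "herm_unit r k a b c \<in> Her r"
  by (rule HerI) (auto simp: herm_unit_def)

lemma herm_unit_swap: "herm_unit r k a b c = herm_unit r k b a (cnj c)"
  by (rule Her_eqI[of _ r]) (auto simp: herm_unit_Her, auto simp: herm_unit_def)

text \<open>Functionals are only real linear, so the complex parameter has to be split before
  linearity applies.\<close>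

lemma herm_unit_decomp:
  "herm_unit r k a b c = tplus (tscale (Re c) (herm_unit r k a b 1)) (tscale (Im c) (herm_unit r k a b \<i>))"
proof (rule Her_eqI)
  fix l i j assume "i < r" "j < r"
  then show "herm_unit r k a b c l $$ (i, j)
      = tplus (tscale (Re c) (herm_unit r k a b 1)) (tscale (Im c) (herm_unit r k a b \<i>)) l $$ (i, j)"
    by (auto simp: herm_unit_def tplus_def tscale_def complex_eq_iff)
qed (auto intro: herm_unit_Her tplus_Her tscale_Her)

lemma sum_herm_units:
  fixes X :: "'d::finite mtuple"
  assumes X: "X \<in> Her r"
  shows "(\<lambda>l. msum r r (\<lambda>(k, a, b). herm_unit r k a b (X k $$ (a, b)) l) (UNIV \<times> {..<r} \<times> {..<r})) = X"
proof (rule Her_eqI[OF _ X])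
  have ent: "msum r r (\<lambda>(k, a, b). herm_unit r k a b (X k $$ (a, b)) l) (UNIV \<times> {..<r} \<times> {..<r}) $$ (i, j)
     = X l $$ (i, j)" if ij: "i < r" "j < r" for l i j
  proof -
    let ?g = "\<lambda>k a b. herm_unit r k a b (X k $$ (a, b)) l $$ (i, j)"
    have "msum r r (\<lambda>(k, a, b). herm_unit r k a b (X k $$ (a, b)) l) (UNIV \<times> {..<r} \<times> {..<r}) $$ (i, j)
      = (\<Sum>k\<in>UNIV. \<Sum>a<r. \<Sum>b<r. ?g k a b)"
      using ij by (simp add: msum_def sum.cartesian_product split_def)
    also have "\<dots> = (\<Sum>k\<in>UNIV. if l = k then \<Sum>a<r. \<Sum>b<r. ?g l a b else 0)"
      using ij by (intro sum.cong refl) (simp add: herm_unit_def)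
    also have "\<dots> = (\<Sum>a<r. \<Sum>b<r. ?g l a b)"
      by simp
    also have "\<dots> = (\<Sum>a<r. \<Sum>b<r. if i = a then if j = b then X l $$ (a, b) / 2 else 0 else 0)
        + (\<Sum>a<r. \<Sum>b<r. if i = b then if j = a then cnj (X l $$ (a, b)) / 2 else 0 else 0)"
      using ij by (simp add: herm_unit_def sum.distrib)
    \<comment> \<open>The order of summation is changed so that the outer index is the one tested
      first; both sums then collapse, each to half of the entry since \<open>X\<close> is
      Hermitian.\<close>
    also have "(\<Sum>a<r. \<Sum>b<r. if i = b then if j = a then cnj (X l $$ (a, b)) / 2 else 0 else 0)
        = (\<Sum>b<r. \<Sum>a<r. if i = b then if j = a then cnj (X l $$ (a, b)) / 2 else 0 else 0)"
      by (rule sum.swap)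
    also have "(\<Sum>a<r. \<Sum>b<r. if i = a then if j = b then X l $$ (a, b) / 2 else 0 else 0)
        = (\<Sum>a<r. if i = a then \<Sum>b<r. if j = b then X l $$ (a, b) / 2 else 0 else 0)"
      by (intro sum.cong refl) simp
    also have "(\<Sum>b<r. \<Sum>a<r. if i = b then if j = a then cnj (X l $$ (a, b)) / 2 else 0 else 0)
        = (\<Sum>b<r. if i = b then \<Sum>a<r. if j = a then cnj (X l $$ (a, b)) / 2 else 0 else 0)"
      by (intro sum.cong refl) simp
    finally show ?thesis
      using ij X by (simp add: Her_cnj)
  qed
  then show "\<And>k i j. i < r \<Longrightarrow> j < r \<Longrightarrow>
      msum r r (\<lambda>(k', a, b). herm_unit r k' a b (X k' $$ (a, b)) k) (UNIV \<times> {..<r} \<times> {..<r}) $$ (i, j)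
      = X k $$ (i, j)" .
  show "(\<lambda>l. msum r r (\<lambda>(k, a, b). herm_unit r k a b (X k $$ (a, b)) l) (UNIV \<times> {..<r} \<times> {..<r})) \<in> Her r"
    by (rule HerI) (use X in \<open>simp_all add: ent Her_cnj\<close>, simp add: msum_def)
qed

text \<open>Membership is proved along with the formula because additivity is available only on
  Hermitian tuples.\<close>

lemma linear_on_Her_msum:
  fixes \<phi> :: "'d mtuple \<Rightarrow> real"
  assumes lin: "linear_on_Her r \<phi>" and "finite I" and "\<And>i. i \<in> I \<Longrightarrow> X i \<in> Her r"
  shows "(\<lambda>k. msum r r (\<lambda>i. X i k) I) \<in> Her r \<and>
    \<phi> (\<lambda>k. msum r r (\<lambda>i. X i k) I) = (\<Sum>i\<in>I. \<phi> (X i))"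
  using assms(2,3)
proof (induction I)
  case empty
  have z: "(\<lambda>k. msum r r (\<lambda>i. X i k) {}) = (\<lambda>k. 0\<^sub>m r r)"
    by (intro ext eq_matI) (auto simp: msum_def)
  have "tscale 0 (\<lambda>k :: 'd. 0\<^sub>m r r) = (\<lambda>k. 0\<^sub>m r r)"
    by (intro ext eq_matI) (auto simp: tscale_def)
  moreover have "\<phi> (tscale 0 (\<lambda>k. 0\<^sub>m r r)) = 0 * \<phi> (\<lambda>k. 0\<^sub>m r r)"
    using lin zero_Her[of r] unfolding linear_on_Her_def by blast
  ultimately have "\<phi> (\<lambda>k. 0\<^sub>m r r) = 0" by simp
  then show ?case unfolding z by (simp add: zero_Her)
next
  case (insert i I)
  have "(\<lambda>k. msum r r (\<lambda>i. X i k) (insert i I)) = tplus (X i) (\<lambda>k. msum r r (\<lambda>i. X i k) I)"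
    using insert by (intro ext eq_matI) (auto simp: msum_def tplus_def Her_dim)
  then show ?case
    using lin insert by (auto simp: linear_on_Her_def intro: tplus_Her)
qed

lemma linear_functional_is_pairing:
  fixes \<phi> :: "'d::finite mtuple \<Rightarrow> real"
  assumes lin: "linear_on_Her r \<phi>"
  obtains T where "T \<in> Her r" "\<And>X. X \<in> Her r \<Longrightarrow> \<phi> X = Re (pairing r T X)"
proof -
  define \<sigma> where "\<sigma> k a b = \<phi> (herm_unit r k a b 1)" for k a b
  define \<rho> where "\<rho> k a b = \<phi> (herm_unit r k a b \<i>)" for k a b
  \<comment> \<open>The real part of \<open>T k $$ (a, b) * c\<close> must be
    \<open>Re c * \<sigma> k a b + Im c * \<rho> k a b\<close>, which forces the minus sign.\<close>
  define T :: "'d mtuple" where "T = (\<lambda>k. mat r r (\<lambda>(a, b). Complex (\<sigma> k a b) (- \<rho> k a b)))"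
  have unit: "\<phi> (herm_unit r k a b c) = Re c * \<sigma> k a b + Im c * \<rho> k a b" for k a b c
    using lin unfolding \<sigma>_def \<rho>_def
    by (subst herm_unit_decomp) (simp add: linear_on_Her_def herm_unit_Her tscale_Her)
  \<comment> \<open>Exchanging \<open>a\<close> and \<open>b\<close> conjugates the parameter: it
    fixes 1 and negates the imaginary unit. Hence \<open>\<sigma>\<close> is symmetric,
    \<open>\<rho>\<close> antisymmetric, and \<open>T\<close> Hermitian.\<close>
  have \<sigma>: "\<sigma> k a b = \<sigma> k b a" for k a b
    using unit[of k a b 1] by (subst (asm) herm_unit_swap) (simp add: unit)
  have \<rho>: "\<rho> k a b = - \<rho> k b a" for k a b
    using unit[of k a b \<i>] by (subst (asm) herm_unit_swap) (simp add: unit)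
  have "T \<in> Her r"
  proof (rule HerI)
    fix k a b assume "a < r" "b < r"
    then show "T k $$ (a, b) = cnj (T k $$ (b, a))"
      using \<sigma>[of k a b] \<rho>[of k a b] by (simp add: T_def complex_eq_iff)
  qed (simp add: T_def)
  moreover have "\<phi> X = Re (pairing r T X)" if X: "X \<in> Her r" for X
  proof -
    have "\<phi> X = \<phi> (\<lambda>l. msum r r (\<lambda>p. (case p of (k, a, b) \<Rightarrow> herm_unit r k a b (X k $$ (a, b))) l)
        (UNIV \<times> {..<r} \<times> {..<r}))"
      using sum_herm_units[OF X] by (simp add: case_prod_beta')
    also have "\<dots> = (\<Sum>p\<in>UNIV \<times> {..<r} \<times> {..<r}. \<phi> (case p of (k, a, b) \<Rightarrow> herm_unit r k a b (X k $$ (a, b))))"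
      by (rule linear_on_Her_msum[OF lin, THEN conjunct2]) (auto intro: herm_unit_Her)
    also have "\<dots> = (\<Sum>k\<in>UNIV. \<Sum>a<r. \<Sum>b<r. \<phi> (herm_unit r k a b (X k $$ (a, b))))"
      by (simp add: sum.cartesian_product split_def)
    also have "\<dots> = Re (pairing r T X)"
      by (simp add: pairing_def unit T_def mult.commute)
    finally show ?thesis .
  qed
  ultimately show ?thesis using that by blast
qed

lemma pairing_herm_unit:
  fixes T :: "'d::finite mtuple"
  assumes T: "T \<in> Her r" and ab: "a < r" "b < r"
  shows "pairing r T (herm_unit r k a b c) = of_real (Re (T k $$ (a, b) * c))"
proof -
  let ?h = "\<lambda>i j. (if i = a then if j = b then c / 2 else 0 else 0) +
     (if i = b then if j = a then cnj c / 2 else 0 else 0)"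
  have "pairing r T (herm_unit r k a b c)
    = (\<Sum>l\<in>UNIV. if l = k then \<Sum>i<r. \<Sum>j<r. T k $$ (i, j) * ?h i j else 0)"
    unfolding pairing_def by (intro sum.cong refl) (simp add: herm_unit_def)
  also have "\<dots> = (\<Sum>i<r. \<Sum>j<r. T k $$ (i, j) * ?h i j)"
    by simp
  also have "\<dots> = (\<Sum>i<r. if i = a then \<Sum>j<r. if j = b then T k $$ (i, j) * c / 2 else 0 else 0)
     + (\<Sum>i<r. if i = b then \<Sum>j<r. if j = a then T k $$ (i, j) * cnj c / 2 else 0 else 0)"
    unfolding sum.distrib[symmetric]
  proof (rule sum.cong[OF refl])
    fix i
    have "(\<Sum>j<r. T k $$ (i, j) * ?h i j)
      = (\<Sum>j<r. (if i = a then if j = b then T k $$ (i, j) * c / 2 else 0 else 0) +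
          (if i = b then if j = a then T k $$ (i, j) * cnj c / 2 else 0 else 0))"
      by (intro sum.cong refl) (simp add: distrib_left)
    then show "(\<Sum>j<r. T k $$ (i, j) * ?h i j)
      = (if i = a then \<Sum>j<r. if j = b then T k $$ (i, j) * c / 2 else 0 else 0)
        + (if i = b then \<Sum>j<r. if j = a then T k $$ (i, j) * cnj c / 2 else 0 else 0)"
      by (simp add: sum.distrib)
  qed
  also have "\<dots> = T k $$ (a, b) * c / 2 + T k $$ (b, a) * cnj c / 2"
    using ab by simp
  also have "T k $$ (b, a) = cnj (T k $$ (a, b))"
    using T ab by (simp add: Her_cnj)
  finally show ?thesis
    by (simp add: complex_eq_iff add_divide_distrib diff_divide_distrib)
qed

text \<open>The induction is Gram--Schmidt on the unit vectors; the support condition on \<open>q\<close> (triangularity)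
  keeps the next vector nonzero.\<close>

lemma positive_form_orthonormal_family:
  fixes P :: "nat \<Rightarrow> nat \<Rightarrow> complex" and r :: nat
  defines "B \<equiv> \<lambda>x y. \<Sum>a<r. \<Sum>b<r. cnj (x a) * P a b * y b"
  assumes herm: "\<And>a b. a < r \<Longrightarrow> b < r \<Longrightarrow> cnj (P a b) = P b a"
    and pos: "\<And>x a. a < r \<Longrightarrow> x a \<noteq> 0 \<Longrightarrow> 0 < Re (B x x)"
    and "m \<le> r"
  shows "\<exists>q. (\<forall>i<m. \<forall>j<m. B (q i) (q j) = (if i = j then 1 else 0)) \<and> (\<forall>i<m. \<forall>a>i. q i a = 0)"
  using \<open>m \<le> r\<close>
proof (induction m)
  case (Suc m)
  then obtain q where "\<forall>i<m. \<forall>j<m. B (q i) (q j) = (if i = j then 1 else 0)"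
    and "\<forall>i<m. \<forall>a>i. q i a = 0" by auto
  then have q: "\<And>i j. i < m \<Longrightarrow> j < m \<Longrightarrow> B (q i) (q j) = (if i = j then 1 else 0)"
    and supp: "\<And>i a. i < m \<Longrightarrow> i < a \<Longrightarrow> q i a = 0" by blast+
  have B_cnj: "cnj (B x y) = B y x" for x y
    unfolding B_def by (subst sum.swap) (simp add: herm mult_ac)
  have B_sum: "B x (\<lambda>a. y a - (\<Sum>i<m. c i * z i a)) = B x y - (\<Sum>i<m. c i * B x (z i))" for x y c z
  proof -
    have "B x (\<lambda>a. y a - (\<Sum>i<m. c i * z i a))
      = B x y - (\<Sum>a<r. \<Sum>b<r. \<Sum>i<m. c i * (cnj (x a) * P a b * z i b))"
      by (simp add: B_def right_diff_distrib sum_subtractf sum_distrib_left mult_ac)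
    also have "(\<Sum>a<r. \<Sum>b<r. \<Sum>i<m. c i * (cnj (x a) * P a b * z i b)) = (\<Sum>i<m. c i * B x (z i))"
      by (simp add: B_def sum_distrib_left sum.swap[of _ "{..<m}"])
    finally show ?thesis .
  qed
  have B_scale: "B x (\<lambda>a. c * y a) = c * B x y" for x y c
    by (simp add: B_def sum_distrib_left mult_ac)
  define e :: "nat \<Rightarrow> complex" where "e = (\<lambda>a. if a = m then 1 else 0)"
  define v where "v = (\<lambda>a. e a - (\<Sum>i<m. B (q i) e * q i a))"
  \<comment> \<open>All earlier vectors vanish at position \<open>m\<close>, so the projection
    leaves this coordinate of \<open>e\<close> untouched.\<close>
  have "v m = 1" by (simp add: v_def e_def supp)
  then have N: "0 < Re (B v v)" using pos[of m v] Suc.prems by simp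
  have Bvv: "B v v = of_real (Re (B v v))"
    using B_cnj[of v v] by (simp add: complex_eq_iff)
  have orth: "B (q j) v = 0" if "j < m" for j
    using that by (simp add: v_def B_sum q if_distrib[of "(*) _"] cong: if_cong)
  define c where "c = complex_of_real (1 / sqrt (Re (B v v)))"
  have cc: "c * (c * B v v) = 1"
    using N by (subst Bvv) (simp add: c_def flip: of_real_mult)
  define w where "w = (\<lambda>a. c * v a)"
  have c_real: "cnj c = c" by (simp add: c_def)
  have qw: "B (q j) w = 0" if "j < m" for j
    using that by (simp add: w_def B_scale orth)
  have wq: "B w (q j) = 0" if "j < m" for j
    using qw[OF that] B_cnj[of "q j" w] by simp
  have "B v w = c * B v v"
    unfolding w_def by (rule B_scale)
  then have "cnj (B v w) = c * B v v"
    using B_cnj[of v v] c_real by simp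
  then have "B w v = c * B v v"
    by (simp add: B_cnj)
  moreover have "B w w = c * B w v"
    by (subst (2) w_def) (rule B_scale)
  ultimately have ww: "B w w = 1"
    using cc by simp
  have "w a = 0" if "a > m" for a
    using that supp by (simp add: w_def v_def e_def)
  then show ?case
    using q qw wq ww supp
    by (intro exI[of _ "q(m := w)"]) (auto simp: less_Suc_eq)
qed simp

text \<open>The form given by the sum of \<open>u k * T k\<close> is positive definite. Congruence
  with a basis orthonormal for it makes the matrix the identity; moved to the other argument of the
  pairing, the congruence becomes compression by \<open>R\<close>. The inverse \<open>S\<close>
  allows this to be undone.\<close>

lemma normalize_pairing:
  fixes T :: "'d::finite mtuple" and u :: "'d \<Rightarrow> real"
  assumes T: "T \<in> Her r"
    and pos: "\<And>v. v \<in> carrier_vec r \<Longrightarrow> v \<noteq> 0\<^sub>v r \<Longrightarrow> 0 < Re (pairing r T (utensor u (outer v)))"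
  obtains T' R S where "T' \<in> Her r" "R \<in> carrier_mat r r" "S \<in> carrier_mat r r" "S * R = 1\<^sub>m r"
    "\<And>a b. a < r \<Longrightarrow> b < r \<Longrightarrow> (\<Sum>k\<in>UNIV. of_real (u k) * T' k $$ (a, b)) = (if a = b then 1 else 0)"
    "\<And>X. X \<in> Her r \<Longrightarrow> pairing r T' X = pairing r T (tcompress R X)"
proof -
  define P where "P = (\<lambda>a b. \<Sum>k\<in>UNIV. complex_of_real (u k) * T k $$ (a, b))"
  define B where "B = (\<lambda>x y. \<Sum>a<r. \<Sum>b<r. cnj (x a) * P a b * y b)"
  have herm: "cnj (P a b) = P b a" if "a < r" "b < r" for a b
    using that T by (simp add: P_def Her_cnj)
  have Bpos: "0 < Re (B x x)" if "a < r" "x a \<noteq> 0" for x :: "nat \<Rightarrow> complex" and a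
  proof -
    \<comment> \<open>The conjugate is needed because \<open>outer\<close> conjugates its second
      factor while \<open>B\<close> conjugates its first argument.\<close>
    let ?v = "vec r (\<lambda>a. cnj (x a))"
    have "?v $ a \<noteq> 0" using that by simp
    then have "?v \<noteq> 0\<^sub>v r" using that by (metis index_zero_vec(1))
    then have "0 < Re (pairing r T (utensor u (outer ?v)))"
      by (intro pos) auto
    also have "pairing r T (utensor u (outer ?v)) = B x x"
      by (subst pairing_utensor) (auto simp: outer_def B_def P_def mult_ac)
    finally show ?thesis .
  qed
  have "\<exists>q. (\<forall>i<r. \<forall>j<r. B (q i) (q j) = (if i = j then 1 else 0)) \<and> (\<forall>i<r. \<forall>a>i. q i a = 0)"
    unfolding B_def
  proof (rule positive_form_orthonormal_family)
    show "cnj (P a b) = P b a" if "a < r" "b < r" for a b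
      using herm that by blast
    show "0 < Re (\<Sum>a<r. \<Sum>b<r. cnj (x a) * P a b * x b)" if "a < r" "x a \<noteq> 0" for x a
      using Bpos[of a x, OF that] unfolding B_def .
  qed simp
  then obtain q where "\<forall>i<r. \<forall>j<r. B (q i) (q j) = (if i = j then 1 else 0)"
    by blast
  then have q: "\<And>i j. i < r \<Longrightarrow> j < r \<Longrightarrow> B (q i) (q j) = (if i = j then 1 else 0)"
    by blast
  \<comment> \<open>\<open>R\<close> is the transpose of \<open>Q\<close>, not its adjoint, because
    the pairing is bilinear. The formula for \<open>S\<close> is chosen so that the entries of
    \<open>R * S\<close> are values of \<open>B\<close> on the orthonormal family.\<close>
  define Q where "Q = mat r r (\<lambda>(a, i). q i a)"
  define R where "R = mat r r (\<lambda>(i, a). q i a)"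
  define S where "S = mat r r (\<lambda>(a, j). \<Sum>b<r. P b a * cnj (q j b))"
  have c: "Q \<in> carrier_mat r r" "R \<in> carrier_mat r r" "S \<in> carrier_mat r r"
    by (auto simp: Q_def R_def S_def)
  have "R * S = 1\<^sub>m r"
  proof (rule eq_matI)
    fix i j assume "i < dim_row (1\<^sub>m r :: complex mat)" "j < dim_col (1\<^sub>m r :: complex mat)"
    then have ij: "i < r" "j < r" by auto
    then have "(R * S) $$ (i, j) = (\<Sum>a<r. q i a * (\<Sum>b<r. P b a * cnj (q j b)))"
      by (simp add: R_def S_def scalar_prod_def atLeast0LessThan)
    also have "\<dots> = B (q j) (q i)"
      unfolding B_def by (subst sum.swap) (simp add: sum_distrib_left mult_ac)
    finally show "(R * S) $$ (i, j) = 1\<^sub>m r $$ (i, j)"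
      using ij q by auto
  qed (use c in auto)
  then have SR: "S * R = 1\<^sub>m r"
    by (rule mat_mult_left_right_inverse[OF c(2,3)])
  have T'_index: "tcompress Q T k $$ (i, j) = (\<Sum>a<r. \<Sum>b<r. cnj (q i a) * T k $$ (a, b) * q j b)"
    if "i < r" "j < r" for k i j
    using that T by (subst index_tcompress[OF c(1)]) (auto simp: Her_carrier Q_def)
  have one: "(\<Sum>k\<in>UNIV. of_real (u k) * tcompress Q T k $$ (i, j)) = (if i = j then 1 else 0)"
    if ij: "i < r" "j < r" for i j
  proof -
    have "(\<Sum>k\<in>UNIV. of_real (u k) * tcompress Q T k $$ (i, j))
       = (\<Sum>k\<in>UNIV. \<Sum>a<r. \<Sum>b<r. of_real (u k) * (cnj (q i a) * T k $$ (a, b) * q j b))"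
      using ij by (simp add: T'_index sum_distrib_left)
    also have "\<dots> = (\<Sum>a<r. \<Sum>b<r. \<Sum>k\<in>UNIV. of_real (u k) * (cnj (q i a) * T k $$ (a, b) * q j b))"
      by (subst sum.swap) (intro sum.cong refl sum.swap)
    also have "\<dots> = B (q i) (q j)"
      by (simp add: B_def P_def sum_distrib_left sum_distrib_right mult_ac)
    finally show ?thesis using q ij by simp
  qed
  have pair: "pairing r (tcompress Q T) X = pairing r T (tcompress R X)" if X: "X \<in> Her r" for X
  proof -
    have "pairing r (tcompress Q T) X = (\<Sum>k\<in>UNIV. \<Sum>i<r. \<Sum>j<r. \<Sum>a<r. \<Sum>b<r.
        T k $$ (a, b) * (cnj (q i a) * X k $$ (i, j) * q j b))"
      by (simp add: pairing_def T'_index sum_distrib_right sum_distrib_left mult_ac)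
    also have "\<dots> = (\<Sum>k\<in>UNIV. \<Sum>a<r. \<Sum>b<r. \<Sum>i<r. \<Sum>j<r.
        T k $$ (a, b) * (cnj (q i a) * X k $$ (i, j) * q j b))"
    proof (rule sum.cong[OF refl])
      fix k :: 'd
      let ?g = "\<lambda>i j a b. T k $$ (a, b) * (cnj (q i a) * X k $$ (i, j) * q j b)"
      have "(\<Sum>i<r. \<Sum>j<r. \<Sum>a<r. \<Sum>b<r. ?g i j a b) = (\<Sum>i<r. \<Sum>a<r. \<Sum>j<r. \<Sum>b<r. ?g i j a b)"
        by (intro sum.cong refl sum.swap)
      also have "\<dots> = (\<Sum>a<r. \<Sum>i<r. \<Sum>b<r. \<Sum>j<r. ?g i j a b)"
        by (subst sum.swap) (intro sum.cong refl sum.swap)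
      also have "\<dots> = (\<Sum>a<r. \<Sum>b<r. \<Sum>i<r. \<Sum>j<r. ?g i j a b)"
        by (intro sum.cong refl sum.swap)
      finally show "(\<Sum>i<r. \<Sum>j<r. \<Sum>a<r. \<Sum>b<r. ?g i j a b) = (\<Sum>a<r. \<Sum>b<r. \<Sum>i<r. \<Sum>j<r. ?g i j a b)" .
    qed
    also have "\<dots> = pairing r T (tcompress R X)"
      unfolding pairing_tcompress[OF c(2) X] by (simp add: R_def)
    finally show ?thesis .
  qed
  show ?thesis
    by (rule that[OF tcompress_Her[OF c(1) T] c(2) c(3) SR]) (simp_all add: one pair)
qed

subsection \<open>Singularity at boundary points\<close>

lemma tcompress_linear:
  assumes V: "V \<in> carrier_mat s t" and A: "A \<in> Her s" and B: "B \<in> Her s"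
  shows "tcompress V (tplus A (tscale c B)) = tplus (tcompress V A) (tscale c (tcompress V B))"
proof (rule Her_eqI)
  note VA = tcompress_Her[OF V A] and VB = tcompress_Her[OF V B]
  show "tcompress V (tplus A (tscale c B)) \<in> Her t"
    by (intro tcompress_Her[OF V] tplus_Her tscale_Her A B)
  show "tplus (tcompress V A) (tscale c (tcompress V B)) \<in> Her t"
    by (intro tplus_Her tscale_Her VA VB)
  fix k a b assume ab: "a < t" "b < t"
  have "tcompress V (tplus A (tscale c B)) k $$ (a, b)
    = (\<Sum>i<s. \<Sum>j<s. cnj (V $$ (i, a)) * tplus A (tscale c B) k $$ (i, j) * V $$ (j, b))"
    by (rule index_tcompress[OF V _ ab]) (intro Her_carrier tplus_Her tscale_Her A B)
  also have "\<dots> = (\<Sum>i<s. \<Sum>j<s. cnj (V $$ (i, a)) * A k $$ (i, j) * V $$ (j, b)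
      + of_real c * (cnj (V $$ (i, a)) * B k $$ (i, j) * V $$ (j, b)))"
    by (intro sum.cong refl)
      (simp add: index_tplus[OF A tscale_Her[OF B]] index_tscale[OF B] algebra_simps)
  also have "\<dots> = tcompress V A k $$ (a, b) + of_real c * tcompress V B k $$ (a, b)"
    by (simp add: index_tcompress[of V s t A k, OF V Her_carrier[OF A] ab] index_tcompress[of V s t B k, OF V Her_carrier[OF B] ab]
        sum.distrib sum_distrib_left)
  also have "\<dots> = tplus (tcompress V A) (tscale c (tcompress V B)) k $$ (a, b)"
    by (simp add: index_tplus[OF VA tscale_Her[OF VB] ab] index_tscale[OF VB ab])
  finally show "tcompress V (tplus A (tscale c B)) k $$ (a, b)
    = tplus (tcompress V A) (tscale c (tcompress V B)) k $$ (a, b)" .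
qed

section \<open>Compactness and the Frobenius norm\<close>

lemma compact_complex_disc: "compact {z :: complex. cmod z \<le> c}"
proof -
  \<comment> \<open>The disc is a closed part of the continuous image of a square.\<close>
  have "compact ((\<lambda>(x, y). of_real x + \<i> * of_real y) ` ({- c..c} \<times> {- c..c}))"
    by (intro compact_continuous_image compact_Times compact_Icc)
      (auto simp: case_prod_beta intro!: continuous_intros)
  then have "compact ((\<lambda>(x, y). of_real x + \<i> * of_real y) ` ({- c..c} \<times> {- c..c})
      \<inter> {z :: complex. cmod z \<le> c})"
    by (intro compact_Int_closed closed_Collect_le continuous_intros)
  moreover have "{z :: complex. cmod z \<le> c} \<subseteq> (\<lambda>(x, y). of_real x + \<i> * of_real y) ` ({- c..c} \<times> {- c..c})"
  proof
    fix z :: complex assume "z \<in> {z. cmod z \<le> c}"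
    then have "\<bar>Re z\<bar> \<le> c" "\<bar>Im z\<bar> \<le> c"
      using abs_Re_le_cmod[of z] abs_Im_le_cmod[of z] by auto
    then show "z \<in> (\<lambda>(x, y). of_real x + \<i> * of_real y) ` ({- c..c} \<times> {- c..c})"
      by (intro image_eqI[of _ _ "(Re z, Im z)"]) (auto simp: complex_eq_iff)
  qed
  ultimately show ?thesis
    by (simp add: Int_absorb1)
qed

text \<open>This is Tychonoff's theorem. The index type is arbitrary because it will have
  coordinates for every boundary point of every level.\<close>

lemma compact_coordinate_bounds:
  fixes c :: "'i \<Rightarrow> real"
  shows "compact {z :: 'i \<Rightarrow> complex. \<forall>i. cmod (z i) \<le> c i}"
proof -
  have "compactin (product_topology (\<lambda>_. euclidean) UNIV) (PiE UNIV (\<lambda>i. {z. cmod z \<le> c i}))"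
    by (simp add: compactin_PiE compact_complex_disc)
  moreover have "PiE UNIV (\<lambda>i. {z. cmod z \<le> c i}) = {z. \<forall>i. cmod (z i) \<le> c i}"
    by (auto simp: PiE_def Pi_def)
  ultimately show ?thesis
    by (simp add: euclidean_product_topology)
qed

definition normsq :: "nat \<Rightarrow> nat \<Rightarrow> complex mat \<Rightarrow> real" where
  "normsq s r V = (\<Sum>i<s. \<Sum>a<r. (cmod (V $$ (i, a)))\<^sup>2)"

lemma normsq_pos:
  assumes "V \<in> carrier_mat s r" "V \<noteq> 0\<^sub>m s r"
  shows "0 < normsq s r V"
proof -
  have "\<exists>i<s. \<exists>a<r. V $$ (i, a) \<noteq> 0"
  proof (rule ccontr)
    assume "\<not> ?thesis"
    then have "V = 0\<^sub>m s r" using assms(1) by (intro eq_matI) auto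
    then show False using assms(2) by simp
  qed
  then obtain i a where "i < s" "a < r" "V $$ (i, a) \<noteq> 0" by blast
  then show ?thesis
    unfolding normsq_def
    by (intro sum_pos2[of _ i] sum_pos2[of _ a] sum_nonneg) auto
qed

lemma normsq_smult:
  "V \<in> carrier_mat s r \<Longrightarrow> normsq s r (of_real c \<cdot>\<^sub>m V) = c\<^sup>2 * normsq s r V"
  by (simp add: normsq_def norm_mult power_mult_distrib sum_distrib_left)

lemma normsq_normalize:
  assumes "V \<in> carrier_mat s r" "V \<noteq> 0\<^sub>m s r"
  shows "normsq s r (of_real (1 / sqrt (normsq s r V)) \<cdot>\<^sub>m V) = 1"
  using normsq_pos[OF assms] by (simp only: normsq_smult[OF assms(1)]) (simp add: power_divide)

lemma norm_index_le_of_normsq: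
  assumes "normsq s r V = 1" "i < s" "a < r"
  shows "cmod (V $$ (i, a)) \<le> 1"
proof -
  have "(cmod (V $$ (i, a)))\<^sup>2 \<le> (\<Sum>a<r. (cmod (V $$ (i, a)))\<^sup>2)"
    using assms(3) by (intro member_le_sum) auto
  also have "\<dots> \<le> normsq s r V"
    unfolding normsq_def using assms(2) by (intro member_le_sum sum_nonneg) auto
  finally show ?thesis using assms(1) by (simp add: abs_square_le_1)
qed

text \<open>Compressing the unit by \<open>V\<close> gives \<open>u\<close> tensored with the Gram
  matrix of the columns of \<open>V\<close>; by the normalization of \<open>T\<close> the pairing
  takes its trace.\<close>

lemma pairing_tcompress_unit:
  fixes T :: "'d::finite mtuple"
  assumes one: "\<And>a b. a < r \<Longrightarrow> b < r \<Longrightarrow> (\<Sum>k\<in>UNIV. of_real (u k) * T k $$ (a, b)) = (if a = b then 1 else 0)"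
    and V: "V \<in> carrier_mat s r"
  shows "pairing r T (tcompress V (utensor u (1\<^sub>m s))) = of_real (normsq s r V)"
proof -
  define G where "G = mat r r (\<lambda>(a, b). \<Sum>i<s. cnj (V $$ (i, a)) * V $$ (i, b))"
  have G: "G \<in> carrier_mat r r" by (simp add: G_def)
  have "tcompress V (utensor u (1\<^sub>m s)) = utensor u G"
  proof (intro ext eq_matI)
    fix k a b assume "a < dim_row (utensor u G k)" "b < dim_col (utensor u G k)"
    then have ab: "a < r" "b < r" by (auto simp: utensor_def G_def)
    then have "tcompress V (utensor u (1\<^sub>m s)) k $$ (a, b)
      = (\<Sum>i<s. \<Sum>j<s. cnj (V $$ (i, a)) * utensor u (1\<^sub>m s) k $$ (i, j) * V $$ (j, b))"
      by (intro index_tcompress[OF V]) (auto simp: utensor_def)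
    also have "\<dots> = (\<Sum>i<s. \<Sum>j<s. if i = j then cnj (V $$ (i, a)) * of_real (u k) * V $$ (j, b) else 0)"
      by (intro sum.cong refl) (simp add: utensor_def)
    also have "\<dots> = utensor u G k $$ (a, b)"
      using ab by (simp add: utensor_def G_def sum_distrib_left mult_ac)
    finally show "tcompress V (utensor u (1\<^sub>m s)) k $$ (a, b) = utensor u G k $$ (a, b)" .
  qed (use V in \<open>auto simp: utensor_def G_def tcompress_def\<close>)
  then have "pairing r T (tcompress V (utensor u (1\<^sub>m s)))
      = (\<Sum>a<r. \<Sum>b<r. (if a = b then 1 else 0) * G $$ (a, b))"
    by (simp add: pairing_utensor[OF G] one)
  also have "\<dots> = (\<Sum>a<r. \<Sum>b<r. if a = b then G $$ (a, b) else 0)"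
    by (intro sum.cong refl) simp
  also have "\<dots> = (\<Sum>a<r. G $$ (a, a))"
    by simp
  also have "\<dots> = (\<Sum>a<r. \<Sum>i<s. of_real ((cmod (V $$ (i, a)))\<^sup>2))"
    by (simp add: G_def complex_norm_square mult.commute del: of_real_power)
  also have "\<dots> = of_real (normsq s r V)"
    unfolding normsq_def of_real_sum by (rule sum.swap)
  finally show ?thesis .
qed

context operator_system
begin

text \<open>The quadratic form of \<open>A\<close> attains a minimum on the compact Frobenius unit
  sphere. If it were positive, subtracting that multiple of the unit from \<open>A\<close> would
  stay in the cone, and adding it back would make \<open>A\<close> an interior point.\<close>

lemma frontier_singular:
  assumes r: "r \<ge> 1" and T: "T \<in> Her r"
    and one: "\<And>a b. a < r \<Longrightarrow> b < r \<Longrightarrow> (\<Sum>k\<in>UNIV. of_real (u k) * T k $$ (a, b)) = (if a = b then 1 else 0)"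
    and C_iff: "\<And>s A. s \<ge> 1 \<Longrightarrow> A \<in> Her s \<Longrightarrow>
      A \<in> C s \<longleftrightarrow> (\<forall>V\<in>carrier_mat s r. 0 \<le> Re (pairing r T (tcompress V A)))"
    and s: "s \<ge> 1" and A: "A \<in> Her_top s frontier_of C s"
  obtains V where "V \<in> carrier_mat s r" "V \<noteq> 0\<^sub>m s r" "pairing r T (tcompress V A) = 0"
proof -
  have AC: "A \<in> C s" and A_int: "A \<notin> Her_top s interior_of C s"
    using A s by (auto simp: frontier_iff)
  have AH: "A \<in> Her s" using AC s mem_Her by blast
  \<comment> \<open>Matrices are parametrized by functions on index pairs, which carry the product
    topology. In \<open>K\<close> the coordinates outside the matrix are bounded as well, for the
    sake of compactness.\<close>
  define M where "M = (\<lambda>w :: nat \<times> nat \<Rightarrow> complex. mat s r w)"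
  define f where "f = (\<lambda>w. Re (pairing r T (tcompress (M w) A)))"
  define K where "K = {w. \<forall>i. norm (w i) \<le> 1} \<inter> {w. normsq s r (M w) = 1}"
  have M: "M w \<in> carrier_mat s r" for w by (simp add: M_def)
  have f_eq: "f w = Re (\<Sum>k\<in>UNIV. \<Sum>a<r. \<Sum>b<r. \<Sum>i<s. \<Sum>j<s.
    T k $$ (a, b) * (cnj (w (i, a)) * A k $$ (i, j) * w (j, b)))" for w
    unfolding f_def pairing_tcompress[OF M AH] by (rule arg_cong[of _ _ Re]) (simp add: M_def)
  have "continuous_on UNIV f"
    unfolding f_eq by (intro continuous_intros continuous_on_product_coordinates)
  have normsq_M: "normsq s r (M w) = (\<Sum>i<s. \<Sum>a<r. (cmod (w (i, a)))\<^sup>2)" for w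
    by (simp add: normsq_def M_def)
  have "closed {w. normsq s r (M w) = 1}"
    unfolding normsq_M by (intro closed_Collect_eq continuous_intros continuous_on_product_coordinates)
  then have "compact K"
    unfolding K_def by (intro compact_Int_closed compact_coordinate_bounds)
  have in_K: "\<exists>w\<in>K. M w = W" if W: "W \<in> carrier_mat s r" "normsq s r W = 1" for W
  proof -
    define w where "w = (\<lambda>(i, a). if i < s \<and> a < r then W $$ (i, a) else 0)"
    have "M w = W" using W by (intro eq_matI) (auto simp: M_def w_def)
    moreover have "norm (w p) \<le> 1" for p
      using norm_index_le_of_normsq[OF W(2)] by (cases p) (simp add: w_def)
    ultimately show ?thesis using W(2) unfolding K_def by (intro bexI[of _ w]) auto
  qed
  let ?E = "mat s r (\<lambda>(i, a). if i = 0 \<and> a = 0 then 1 else 0) :: complex mat"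
  have "?E $$ (0, 0) = 1" using s r by simp
  then have E: "?E \<in> carrier_mat s r" "?E \<noteq> 0\<^sub>m s r"
    using s r by (auto dest!: arg_cong[of _ _ "\<lambda>M. M $$ (0, 0)"])
  have "K \<noteq> {}"
    using in_K[OF smult_carrier_mat[OF E(1)] normsq_normalize[OF E]] by blast
  obtain w where w: "w \<in> K" "\<And>w'. w' \<in> K \<Longrightarrow> f w \<le> f w'"
    using continuous_attains_inf[OF \<open>compact K\<close> \<open>K \<noteq> {}\<close>] \<open>continuous_on UNIV f\<close>
    by (meson continuous_on_subset subset_UNIV)
  have f_nonneg: "0 \<le> f w"
    using C_iff[OF s AH] AC M unfolding f_def by blast
  have "f w = 0"
  proof (rule ccontr)
    assume "f w \<noteq> 0"
    then have m: "f w > 0" using f_nonneg by simp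
    let ?B = "tplus A (tscale (- f w) (unit s))"
    note IH = utensor_one_Her[of u s]
    have BH: "?B \<in> Her s" by (intro tplus_Her tscale_Her AH IH)
    have "0 \<le> Re (pairing r T (tcompress V ?B))" if V: "V \<in> carrier_mat s r" for V
    proof -
      have "tcompress V ?B = tplus (tcompress V A) (tscale (- f w) (tcompress V (unit s)))"
        by (rule tcompress_linear[OF V AH IH])
      then have p: "Re (pairing r T (tcompress V ?B)) = Re (pairing r T (tcompress V A)) - f w * normsq s r V"
        by (simp add: pairing_tplus tcompress_Her[OF V] AH IH tscale_Her pairing_tscale[OF tcompress_Her[OF V IH]]
            pairing_tcompress_unit[OF one V])
      show ?thesis
      proof (cases "V = 0\<^sub>m s r")
        case True
        then have "normsq s r V = 0" by (simp add: normsq_def)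
        moreover have "0 \<le> Re (pairing r T (tcompress V A))" using C_iff[OF s AH] AC V by blast
        ultimately show ?thesis using p by simp
      next
        case False
        \<comment> \<open>The form is homogeneous of degree 2, so a nonzero \<open>V\<close> is
          compared with its normalization.\<close>
        let ?c = "1 / sqrt (normsq s r V)"
        have N: "normsq s r V > 0" using normsq_pos[OF V False] .
        obtain w' where "w' \<in> K" "M w' = of_real ?c \<cdot>\<^sub>m V"
          using in_K[OF smult_carrier_mat[OF V] normsq_normalize[OF V False]] by blast
        then have "f w \<le> Re (pairing r T (tcompress (of_real ?c \<cdot>\<^sub>m V) A))"
          using w(2) unfolding f_def by metis
        also have "\<dots> = Re (pairing r T (tcompress V A)) / normsq s r V"
          using N by (simp only: tcompress_smult[OF V AH] pairing_tscale[OF tcompress_Her[OF V AH]])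
            (simp add: power_divide)
        finally show ?thesis using p N by (simp add: field_simps)
      qed
    qed
    then have "?B \<in> C s" using C_iff[OF s BH] by blast
    then have "tplus ?B (tscale (f w) (unit s)) \<in> Her_top s interior_of C s"
      using tplus_unit_in_interior[OF s _ m] by blast
    moreover have "tplus ?B (tscale (f w) (unit s)) = A"
      using AH IH BH by (intro Her_eqI[of _ s] tplus_Her tscale_Her) (auto simp: tplus_def tscale_def Her_dim)
    ultimately show False using A_int by simp
  qed
  moreover have "M w \<noteq> 0\<^sub>m s r"
    using w(1) by (auto simp: K_def normsq_def)
  moreover have "Im (pairing r T (tcompress (M w) A)) = 0"
    by (intro pairing_real tcompress_Her[of _ s] T M AH)
  ultimately show ?thesis
    using M by (intro that[of "M w"]) (auto simp: f_def complex_eq_iff)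
qed

end

subsection \<open>Common states\<close>

definition unital :: "nat \<Rightarrow> ('d::finite \<Rightarrow> real) \<Rightarrow> 'd mtuple \<Rightarrow> bool" where
  "unital r u T \<longleftrightarrow> (\<forall>a<r. \<forall>b<r. (\<Sum>k\<in>UNIV. of_real (u k) * T k $$ (a, b)) = (if a = b then 1 else 0))"

lemma unitalD:
  "unital r u T \<Longrightarrow> a < r \<Longrightarrow> b < r \<Longrightarrow>
    (\<Sum>k\<in>UNIV. of_real (u k) * T k $$ (a, b)) = (if a = b then 1 else 0)"
  by (simp add: unital_def)

lemma msum_eq_one_iff:
  assumes "T \<in> Her r"
  shows "msum r r (\<lambda>k. complex_of_real (u k) \<cdot>\<^sub>m T k) UNIV = 1\<^sub>m r \<longleftrightarrow> unital r u T"
proof -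
  have "msum r r (\<lambda>k. complex_of_real (u k) \<cdot>\<^sub>m T k) UNIV = 1\<^sub>m r \<longleftrightarrow>
    (\<forall>a<r. \<forall>b<r. msum r r (\<lambda>k. complex_of_real (u k) \<cdot>\<^sub>m T k) UNIV $$ (a, b) = 1\<^sub>m r $$ (a, b))"
    by (subst mat_eq_iff) (simp add: msum_def)
  then show ?thesis
    using assms by (simp add: unital_def msum_def Her_dim)
qed

text \<open>From here on realizability is handled through compressions and the pairing alone,
  without Kronecker products.\<close>

lemma realizable_iff:
  "realizable r C u \<longleftrightarrow> (\<exists>T\<in>Her r. unital r u T \<and>
    (\<forall>s\<ge>1. \<forall>A\<in>Her s. A \<in> C s \<longleftrightarrow> (\<forall>V\<in>carrier_mat s r. 0 \<le> Re (pairing r T (tcompress V A)))))"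
  unfolding realizable_def
  by (intro bex_cong refl conj_cong all_cong ball_cong) (simp_all add: msum_eq_one_iff psd_kronecker_sum_iff)

lemma tcompress_one:
  assumes "X \<in> Her r"
  shows "tcompress (1\<^sub>m r) X = X"
proof
  fix k
  have "mat_adjoint (1\<^sub>m r :: complex mat) = 1\<^sub>m r"
    by (rule eq_matI) (auto simp: index_mat_adjoint)
  then show "tcompress (1\<^sub>m r) X k = X k"
    using Her_carrier[OF assms, of k] by (simp add: tcompress_def)
qed

lemma linear_on_Her_pairing: "linear_on_Her r (\<lambda>X. Re (pairing r T X))"
  by (simp add: linear_on_Her_def pairing_tplus pairing_tscale)

lemma pairing_utensor_outer:
  assumes "unital r u T" "v \<in> carrier_vec r"
  shows "pairing r T (utensor u (outer v)) = of_real (\<Sum>a<r. (cmod (v $ a))\<^sup>2)"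
proof -
  have "outer v \<in> carrier_mat r r" using assms(2) by (simp add: outer_def)
  then have "pairing r T (utensor u (outer v)) = (\<Sum>a<r. \<Sum>b<r. (if a = b then 1 else 0) * outer v $$ (a, b))"
    by (simp add: pairing_utensor unitalD[OF assms(1)])
  also have "\<dots> = (\<Sum>a<r. \<Sum>b<r. if a = b then outer v $$ (a, b) else 0)"
    by (intro sum.cong refl) simp
  also have "\<dots> = (\<Sum>a<r. outer v $$ (a, a))"
    by simp
  also have "\<dots> = of_real (\<Sum>a<r. (cmod (v $ a))\<^sup>2)"
    using assms(2) by (simp add: outer_def complex_norm_square del: of_real_power)
  finally show ?thesis .
qed

lemma sum_norm_square_pos:
  assumes "v \<in> carrier_vec r" "v \<noteq> 0\<^sub>v r"
  shows "0 < (\<Sum>a<r. (cmod (v $ a))\<^sup>2)"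
proof -
  have "\<exists>a<r. v $ a \<noteq> 0"
  proof (rule ccontr)
    assume "\<not> ?thesis"
    then have "v = 0\<^sub>v r" using assms(1) by (intro eq_vecI) auto
    then show False using assms(2) by simp
  qed
  then obtain a where "a < r" "v $ a \<noteq> 0" by blast
  then show ?thesis by (intro sum_pos2[of _ a]) auto
qed

section \<open>The two directions of the equivalence\<close>

context operator_system
begin

lemma zero_mem_C:
  assumes "s \<ge> 1"
  shows "(\<lambda>k. 0\<^sub>m s s) \<in> C s"
proof -
  have "tscale 0 (unit s) = (\<lambda>k. 0\<^sub>m s s)"
    by (intro ext eq_matI) (auto simp: tscale_def utensor_def)
  then show ?thesis
    using scale_closed[OF assms unit_mem_C[OF assms], of 0] by simp
qed

lemma msum_mem_C:
  assumes "r \<ge> 1" "finite I" "\<And>i. i \<in> I \<Longrightarrow> X i \<in> C r"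
  shows "(\<lambda>k. msum r r (\<lambda>i. X i k) I) \<in> C r"
  using assms(2,3)
proof (induction I)
  case empty
  have "(\<lambda>k. msum r r (\<lambda>i. X i k) {}) = (\<lambda>k. 0\<^sub>m r r)"
    by (intro ext eq_matI) (auto simp: msum_def)
  then show ?case using zero_mem_C assms(1) by simp
next
  case (insert i I)
  have "X i \<in> Her r" using mem_Her assms(1) insert by blast
  then have "(\<lambda>k. msum r r (\<lambda>i. X i k) (insert i I)) = tplus (X i) (\<lambda>k. msum r r (\<lambda>i. X i k) I)"
    using insert by (intro ext eq_matI) (auto simp: msum_def tplus_def Her_dim)
  then show ?case using insert assms(1) by (simp add: add_closed)
qed

text \<open>One functional, the pairing with \<open>T\<close>, vanishes on every summand, hence on
  the sum. The normalization of \<open>T\<close> makes it strictly positive where the essential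
  boundary requires it.\<close>

lemma ess_boundary_of_realization:
  fixes A :: "nat \<Rightarrow> 'd mtuple"
  assumes r: "r \<ge> 1" and T: "T \<in> Her r" and one: "unital r u T"
    and C_iff: "\<And>s A. s \<ge> 1 \<Longrightarrow> A \<in> Her s \<Longrightarrow>
      A \<in> C s \<longleftrightarrow> (\<forall>V\<in>carrier_mat s r. 0 \<le> Re (pairing r T (tcompress V A)))"
    and A: "\<And>i. i < n \<Longrightarrow> s i \<ge> 1 \<and> A i \<in> Her_top (s i) frontier_of C (s i)"
  shows "\<exists>V. (\<forall>i<n. V i \<in> carrier_mat (s i) r \<and> V i \<noteq> 0\<^sub>m (s i) r) \<and>
    (\<lambda>k. msum r r (\<lambda>i. tcompress (V i) (A i) k) {..<n}) \<in> ess_boundary C u r"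
proof -
  have "\<exists>W. W \<in> carrier_mat (s i) r \<and> W \<noteq> 0\<^sub>m (s i) r \<and> pairing r T (tcompress W (A i)) = 0" if "i < n" for i
    using frontier_singular[OF r T unitalD[OF one] C_iff, of "s i" "A i"] A[OF that] by metis
  then obtain V where V: "\<And>i. i < n \<Longrightarrow> V i \<in> carrier_mat (s i) r"
    "\<And>i. i < n \<Longrightarrow> V i \<noteq> 0\<^sub>m (s i) r" "\<And>i. i < n \<Longrightarrow> pairing r T (tcompress (V i) (A i)) = 0"
    by metis
  let ?X = "\<lambda>k. msum r r (\<lambda>i. tcompress (V i) (A i) k) {..<n}"
  let ?\<phi> = "\<lambda>X. Re (pairing r T X)"
  have "tcompress (V i) (A i) \<in> C r" if "i < n" for i
    using compress_closed[of "s i" r "A i" "V i"] A[OF that] V(1)[OF that] r frontier_iff by blast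
  then have "?X \<in> C r"
    using r by (intro msum_mem_C) auto
  moreover have "?\<phi> \<in> dual_cone r (C r)"
  proof -
    \<comment> \<open>The criterion at level \<open>r\<close> is applied to the identity as
      compressing matrix.\<close>
    have "0 \<le> ?\<phi> X" if "X \<in> C r" for X
      using C_iff[of r X] that r mem_Her[OF r that] tcompress_one[of X r] one_carrier_mat[of r] by metis
    then show ?thesis by (simp add: dual_cone_def linear_on_Her_pairing)
  qed
  moreover have "0 < ?\<phi> (utensor u (outer v))" if "v \<in> carrier_vec r - {0\<^sub>v r}" for v
    using that sum_norm_square_pos[of v r] by (simp add: pairing_utensor_outer[OF one])
  moreover have "pairing r T ?X = (\<Sum>i<n. pairing r T (tcompress (V i) (A i)))"
    by (rule pairing_msum, rule tcompress_carrier[OF V(1)]) simp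
  then have "?\<phi> ?X = 0"
    by (simp add: V(3))
  ultimately have "?X \<in> ess_boundary C u r"
    unfolding ess_boundary_def by (intro CollectI conjI bexI[of _ ?\<phi>] ballI)
  then show ?thesis using V(1,2) by (intro exI[of _ V]) simp
qed

text \<open>The normalization is an equation between matrices and not only a scalar one, so strict
  positivity on \<open>utensor u (outer v)\<close> is encoded in a closed condition.\<close>

definition states :: "nat \<Rightarrow> 'd mtuple set" where
  "states r = {T \<in> Her r. unital r u T \<and> (\<forall>X\<in>C r. 0 \<le> Re (pairing r T X))}"

text \<open>A functional that is nonnegative on the cone and zero on a sum of cone elements is zero
  on each of them. The functional is then normalized by a congruence, and the kernel matrices are
  adjusted and rescaled accordingly.\<close>

lemma common_zero:
  fixes A :: "nat \<Rightarrow> 'd mtuple"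
  assumes r: "r \<ge> 1"
    and A: "\<And>i. i < n \<Longrightarrow> s i \<ge> 1 \<and> A i \<in> C (s i)"
    and V: "\<And>i. i < n \<Longrightarrow> V i \<in> carrier_mat (s i) r \<and> V i \<noteq> 0\<^sub>m (s i) r"
    and ess: "(\<lambda>k. msum r r (\<lambda>i. tcompress (V i) (A i) k) {..<n}) \<in> ess_boundary C u r"
  obtains T W where "T \<in> states r"
    "\<And>i. i < n \<Longrightarrow> W i \<in> carrier_mat (s i) r \<and> normsq (s i) r (W i) = 1 \<and> pairing r T (tcompress (W i) (A i)) = 0"
proof -
  obtain \<phi> where \<phi>: "linear_on_Her r \<phi>" "\<And>X. X \<in> C r \<Longrightarrow> 0 \<le> \<phi> X"
    "\<And>v. v \<in> carrier_vec r \<Longrightarrow> v \<noteq> 0\<^sub>v r \<Longrightarrow> 0 < \<phi> (utensor u (outer v))"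
    "\<phi> (\<lambda>k. msum r r (\<lambda>i. tcompress (V i) (A i) k) {..<n}) = 0"
    using ess unfolding ess_boundary_def dual_cone_def by blast
  obtain T where T: "T \<in> Her r" "\<And>X. X \<in> Her r \<Longrightarrow> \<phi> X = Re (pairing r T X)"
    using linear_functional_is_pairing[OF \<phi>(1)] by blast
  have "0 < Re (pairing r T (utensor u (outer v)))" if "v \<in> carrier_vec r" "v \<noteq> 0\<^sub>v r" for v
    using \<phi>(3)[OF that] T(2)[OF utensor_Her[OF outer_hermitian[OF that(1)]]] by simp
  then obtain T' R S where T': "T' \<in> Her r" "R \<in> carrier_mat r r" "S \<in> carrier_mat r r" "S * R = 1\<^sub>m r"
    "\<And>a b. a < r \<Longrightarrow> b < r \<Longrightarrow> (\<Sum>k\<in>UNIV. of_real (u k) * T' k $$ (a, b)) = (if a = b then 1 else 0)"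
    "\<And>X. X \<in> Her r \<Longrightarrow> pairing r T' X = pairing r T (tcompress R X)"
    using normalize_pairing[OF T(1), of u] by blast
  have nonneg: "0 \<le> Re (pairing r T X)" if "X \<in> C r" for X
    using \<phi>(2)[OF that] T(2) mem_Her[OF r that] by simp
  have "0 \<le> Re (pairing r T' X)" if "X \<in> C r" for X
    using T'(2,6) mem_Her[OF r that] nonneg compress_closed[OF r r that T'(2)] by simp
  then have state: "T' \<in> states r"
    using T'(1,5) by (simp add: states_def unital_def)
  have VA: "tcompress (V i) (A i) \<in> C r" if "i < n" for i
    using A[OF that] V[OF that] r compress_closed[of "s i" r "A i" "V i"] by simp
  have "(\<Sum>i<n. Re (pairing r T (tcompress (V i) (A i)))) = 0"
  proof -
    have "(\<Sum>i<n. pairing r T (tcompress (V i) (A i)))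
      = pairing r T (\<lambda>k. msum r r (\<lambda>i. tcompress (V i) (A i) k) {..<n})"
      by (rule pairing_msum[symmetric], rule tcompress_carrier[OF conjunct1[OF V]]) simp
    then have "(\<Sum>i<n. Re (pairing r T (tcompress (V i) (A i))))
      = Re (pairing r T (\<lambda>k. msum r r (\<lambda>i. tcompress (V i) (A i) k) {..<n}))"
      by (simp flip: Re_sum)
    also have "\<dots> = \<phi> (\<lambda>k. msum r r (\<lambda>i. tcompress (V i) (A i) k) {..<n})"
      using VA r by (intro T(2)[symmetric] mem_Her msum_mem_C) auto
    finally show ?thesis using \<phi>(4) by simp
  qed
  then have Re_zero: "Re (pairing r T (tcompress (V i) (A i))) = 0" if "i < n" for i
    using that nonneg VA by (subst (asm) sum_nonneg_eq_0_iff) auto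
  have zero: "pairing r T (tcompress (V i) (A i)) = 0" if "i < n" for i
    using Re_zero[OF that] pairing_real[OF T(1) mem_Her[OF r VA[OF that]]] by (simp add: complex_eq_iff)
  \<comment> \<open>Compressing further by \<open>R\<close> turns \<open>V i * S\<close> back into
    \<open>V i\<close>, so the zero is kept; for the same reason \<open>V i * S\<close> is nonzero
    and can be normalized.\<close>
  define W where "W i = of_real (1 / sqrt (normsq (s i) r (V i * S))) \<cdot>\<^sub>m (V i * S)" for i
  have "W i \<in> carrier_mat (s i) r \<and> normsq (s i) r (W i) = 1 \<and> pairing r T' (tcompress (W i) (A i)) = 0"
    if i: "i < n" for i
  proof (intro conjI)
    have V': "V i \<in> carrier_mat (s i) r" "V i \<noteq> 0\<^sub>m (s i) r" and AH: "A i \<in> Her (s i)"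
      using V[OF i] A[OF i] mem_Her by auto
    have VS: "V i * S \<in> carrier_mat (s i) r" using V'(1) T'(3) by auto
    have VSR: "V i * S * R = V i"
      using V'(1) T'(2,3,4) by (simp add: assoc_mult_mat[of _ "s i" r _ r _ r])
    have "V i * S \<noteq> 0\<^sub>m (s i) r"
    proof
      assume "V i * S = 0\<^sub>m (s i) r"
      then have "V i = 0\<^sub>m (s i) r * R" using VSR by simp
      then show False using V'(2) T'(2) by simp
    qed
    then show "normsq (s i) r (W i) = 1"
      unfolding W_def by (rule normsq_normalize[OF VS])
    show "W i \<in> carrier_mat (s i) r" using VS by (simp add: W_def)
    have "pairing r T' (tcompress (V i * S) (A i)) = pairing r T (tcompress (V i) (A i))"
      by (simp add: T'(6)[OF tcompress_Her[OF VS AH]] tcompress_tcompress[OF VS T'(2) AH] VSR)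
    then show "pairing r T' (tcompress (W i) (A i)) = 0"
      by (simp only: W_def tcompress_smult[OF VS AH] pairing_tscale[OF tcompress_Her[OF VS AH]] zero[OF i]) simp
  qed
  then show ?thesis using that state by blast
qed

text \<open>The order unit dominates \<open>X\<close> and \<open>-X\<close> up to a constant, and
  all states agree at the unit. Hence each \<open>X\<close> is bounded over the states, and
  Hermitian matrix units read off the entries.\<close>

lemma states_bounded:
  assumes r: "r \<ge> 1"
  shows "\<exists>c. \<forall>T\<in>states r. \<forall>a<r. \<forall>b<r. cmod (T k $$ (a, b)) \<le> c a b"
proof -
  have bound: "\<exists>c. \<forall>T\<in>states r. \<bar>Re (pairing r T X)\<bar> \<le> c" if X: "X \<in> Her r" for X
  proof -
    obtain c where c: "c > 0" "tplus (tscale c (unit r)) X \<in> C r"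
        "tplus (tscale c (unit r)) (tscale (- 1) X) \<in> C r"
      using unit_dominates[OF r X] by blast
    have b: "\<bar>Re (pairing r T X)\<bar> \<le> c * Re (pairing r T (unit r))
        \<and> Re (pairing r T (unit r)) = normsq r r (1\<^sub>m r)" if T: "T \<in> states r" for T
    proof
      have "0 \<le> Re (pairing r T (tplus (tscale c (unit r)) X))"
        "0 \<le> Re (pairing r T (tplus (tscale c (unit r)) (tscale (- 1) X)))"
        using T c by (auto simp: states_def)
      then show "\<bar>Re (pairing r T X)\<bar> \<le> c * Re (pairing r T (unit r))"
        using X utensor_one_Her[of u r] by (simp add: pairing_tplus pairing_tscale tscale_Her)
      have "pairing r T (tcompress (1\<^sub>m r) (unit r)) = of_real (normsq r r (1\<^sub>m r))"
        using T by (intro pairing_tcompress_unit unitalD) (auto simp: states_def)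
      then show "Re (pairing r T (unit r)) = normsq r r (1\<^sub>m r)"
        by (simp add: tcompress_one[OF utensor_one_Her])
    qed
    show ?thesis
    proof (intro exI ballI)
      show "\<bar>Re (pairing r T X)\<bar> \<le> c * normsq r r (1\<^sub>m r)" if "T \<in> states r" for T
        using b[OF that] by auto
    qed
  qed
  have "\<exists>c. \<forall>T\<in>states r. a < r \<longrightarrow> b < r \<longrightarrow> cmod (T k $$ (a, b)) \<le> c" for a b
  proof -
    obtain c1 c2 where c: "\<And>T. T \<in> states r \<Longrightarrow> \<bar>Re (pairing r T (herm_unit r k a b 1))\<bar> \<le> c1"
      "\<And>T. T \<in> states r \<Longrightarrow> \<bar>Re (pairing r T (herm_unit r k a b \<i>))\<bar> \<le> c2"
      using bound[OF herm_unit_Her] by metis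
    \<comment> \<open>The parameters 1 and the imaginary unit yield the real part and minus the
      imaginary part of the entry.\<close>
    have "cmod (T k $$ (a, b)) \<le> c1 + c2" if "T \<in> states r" "a < r" "b < r" for T
      using c[OF that(1)] cmod_le[of "T k $$ (a, b)"] that
      by (simp add: states_def pairing_herm_unit)
    then show ?thesis by blast
  qed
  then show ?thesis by metis
qed

text \<open>Tychonoff's theorem is applied to the entries of \<open>T\<close> together with those of one normalized kernel
  matrix per boundary point, so that all conditions become polynomial in the coordinates.\<close>

lemma exists_common_state:
  assumes r: "r \<ge> 1"
    and compr: "\<And>(n::nat) s A. n \<ge> 1 \<Longrightarrow> (\<And>i. i < n \<Longrightarrow> s i \<ge> 1 \<and> A i \<in> Her_top (s i) frontier_of C (s i)) \<Longrightarrow>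
       \<exists>V. (\<forall>i<n. V i \<in> carrier_mat (s i) r \<and> V i \<noteq> 0\<^sub>m (s i) r) \<and>
          (\<lambda>k. msum r r (\<lambda>i. tcompress (V i) (A i) k) {..<n}) \<in> ess_boundary C u r"
  obtains T where "T \<in> states r"
    "\<And>s A. s \<ge> 1 \<Longrightarrow> A \<in> Her_top s frontier_of C s \<Longrightarrow>
      \<exists>W\<in>carrier_mat s r. normsq s r W = 1 \<and> pairing r T (tcompress W A) = 0"
proof -
  define I where "I = {p. fst p \<ge> 1 \<and> snd p \<in> Her_top (fst p) frontier_of C (fst p)}"
  define TT :: "('d \<times> nat \<times> nat + (nat \<times> 'd mtuple) \<times> nat \<times> nat \<Rightarrow> complex) \<Rightarrow> 'd mtuple"
    where "TT z = (\<lambda>k. mat r r (\<lambda>(a, b). z (Inl (k, a, b))))" for z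
  define WW :: "('d \<times> nat \<times> nat + (nat \<times> 'd mtuple) \<times> nat \<times> nat \<Rightarrow> complex) \<Rightarrow> nat \<times> 'd mtuple \<Rightarrow> complex mat"
    where "WW z p = mat (fst p) r (\<lambda>(i, a). z (Inr (p, i, a)))" for z p
  have "\<forall>k. \<exists>c. \<forall>T\<in>states r. \<forall>a<r. \<forall>b<r. cmod (T k $$ (a, b)) \<le> c a b"
    by (intro allI states_bounded[OF r])
  from choice[OF this] obtain c where c0: "\<forall>k. \<forall>T\<in>states r. \<forall>a<r. \<forall>b<r. cmod (T k $$ (a, b)) \<le> c k a b"
    by (rule exE)
  have c: "cmod (T k $$ (a, b)) \<le> c k a b" if "T \<in> states r" "a < r" "b < r" for k T a b
    using bspec[OF c0[THEN spec, of k] that(1)] that(2,3) by simp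
  define bnd :: "'d \<times> nat \<times> nat + (nat \<times> 'd mtuple) \<times> nat \<times> nat \<Rightarrow> real"
    where "bnd = case_sum (\<lambda>(k, a, b). max 0 (c k a b)) (\<lambda>_. 1)"
  define F where "F p = {z. TT z \<in> states r \<and> normsq (fst p) r (WW z p) = 1 \<and>
     pairing r (TT z) (tcompress (WW z p) (snd p)) = 0}" for p
  note cont = continuous_intros continuous_on_product_coordinates
  \<comment> \<open>Each condition is an equation or a weak inequality in finitely many coordinates,
    and arbitrary intersections of closed sets are closed.\<close>
  have closed_states: "closed {z. TT z \<in> states r}"
  proof -
    have "TT z \<in> states r \<longleftrightarrow>
      (\<forall>k. \<forall>a\<in>{..<r}. \<forall>b\<in>{..<r}. z (Inl (k, a, b)) = cnj (z (Inl (k, b, a)))) \<and>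
      (\<forall>a\<in>{..<r}. \<forall>b\<in>{..<r}. (\<Sum>k\<in>UNIV. of_real (u k) * z (Inl (k, a, b))) = (if a = b then 1 else 0)) \<and>
      (\<forall>X\<in>C r. 0 \<le> Re (\<Sum>k\<in>UNIV. \<Sum>a<r. \<Sum>b<r. z (Inl (k, a, b)) * X k $$ (a, b)))" for z
    proof -
      have "TT z \<in> Her r \<longleftrightarrow> (\<forall>k. \<forall>a\<in>{..<r}. \<forall>b\<in>{..<r}. z (Inl (k, a, b)) = cnj (z (Inl (k, b, a))))"
        by (simp add: Her_def hermitian_mat_iff TT_def Ball_def)
      moreover have "unital r u (TT z) \<longleftrightarrow>
        (\<forall>a\<in>{..<r}. \<forall>b\<in>{..<r}. (\<Sum>k\<in>UNIV. of_real (u k) * z (Inl (k, a, b))) = (if a = b then 1 else 0))"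
        by (simp add: unital_def TT_def Ball_def)
      moreover have "pairing r (TT z) X = (\<Sum>k\<in>UNIV. \<Sum>a<r. \<Sum>b<r. z (Inl (k, a, b)) * X k $$ (a, b))" for X
        by (simp add: pairing_def TT_def)
      ultimately show ?thesis by (simp only: states_def mem_Collect_eq)
    qed
    then show ?thesis
      by (simp only: Ball_def) (intro closed_Collect_conj closed_Collect_all closed_Collect_imp open_Collect_const
          closed_Collect_eq closed_Collect_le cont)
  qed
  have closed_F: "closed (F p)" if "p \<in> I" for p
  proof -
    obtain s A where p: "p = (s, A)" by fastforce
    have AH: "A \<in> Her s" using that mem_Her by (auto simp: I_def p frontier_iff)
    have W: "WW z p \<in> carrier_mat s r" for z by (simp add: WW_def p)
    have "F p = {z. TT z \<in> states r} \<inter> {z. (\<Sum>i<s. \<Sum>a<r. (cmod (z (Inr (p, i, a))))\<^sup>2) = 1} \<inter>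
      {z. (\<Sum>k\<in>UNIV. \<Sum>a<r. \<Sum>b<r. \<Sum>i<s. \<Sum>j<s. z (Inl (k, a, b)) *
          (cnj (z (Inr (p, i, a))) * A k $$ (i, j) * z (Inr (p, j, b)))) = 0}"
      unfolding F_def by (auto simp: p normsq_def pairing_tcompress[OF W[unfolded p] AH]) (auto simp: WW_def TT_def)
    also have "closed \<dots>"
      by (intro closed_Int closed_states closed_Collect_eq cont)
    finally show ?thesis .
  qed
  obtain A0 where "A0 \<in> Her_top 1 frontier_of C 1" using exists_frontier by blast
  then have p0: "(1, A0) \<in> I" by (simp add: I_def)
  let ?Z = "{z. \<forall>x. cmod (z x) \<le> bnd x}"
  have fip: "?Z \<inter> (\<Inter>p\<in>J. F p) \<noteq> {}" if J: "finite J" "J \<subseteq> I" for J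
  proof -
    \<comment> \<open>The compression hypothesis needs at least one boundary point, also when
      \<open>J\<close> is empty.\<close>
    define J' where "J' = insert (1, A0) J"
    have J': "finite J'" "J' \<subseteq> I" "J' \<noteq> {}" using J p0 by (auto simp: J'_def)
    obtain p where p: "bij_betw p {..<card J'} J'"
      using ex_bij_betw_nat_finite[OF J'(1)] by (auto simp: atLeast0LessThan)
    define n where "n = card J'"
    have n: "n \<ge> 1" using J' by (simp add: n_def Suc_le_eq card_gt_0_iff)
    have pI: "p i \<in> I" if "i < n" for i using p that J'(2) by (auto simp: bij_betw_def n_def)
    have fr: "fst (p i) \<ge> 1 \<and> snd (p i) \<in> Her_top (fst (p i)) frontier_of C (fst (p i))" if "i < n" for i
      using pI[OF that] by (simp add: I_def)
    obtain V where V: "\<And>i. i < n \<Longrightarrow> V i \<in> carrier_mat (fst (p i)) r \<and> V i \<noteq> 0\<^sub>m (fst (p i)) r"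
      "(\<lambda>k. msum r r (\<lambda>i. tcompress (V i) (snd (p i)) k) {..<n}) \<in> ess_boundary C u r"
      using compr[of n "\<lambda>i. fst (p i)" "\<lambda>i. snd (p i)", OF n fr] by blast
    have inC: "fst (p i) \<ge> 1 \<and> snd (p i) \<in> C (fst (p i))" if "i < n" for i
      using fr[OF that] frontier_iff by blast
    obtain T W where T: "T \<in> states r"
      and W: "\<And>i. i < n \<Longrightarrow> W i \<in> carrier_mat (fst (p i)) r \<and> normsq (fst (p i)) r (W i) = 1 \<and>
        pairing r T (tcompress (W i) (snd (p i))) = 0"
      using common_zero[OF r inC V] by blast
    have "\<forall>x\<in>J'. \<exists>i. i < n \<and> p i = x"
    proof
      fix x assume "x \<in> J'"
      then have "x \<in> p ` {..<n}"
        using bij_betw_imp_surj_on[OF p] by (simp add: n_def)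
      then show "\<exists>i. i < n \<and> p i = x" by blast
    qed
    from bchoice[OF this] obtain q where "\<forall>x\<in>J'. q x < n \<and> p (q x) = x"
      by (rule exE)
    then have q: "\<And>x. x \<in> J' \<Longrightarrow> q x < n" "\<And>x. x \<in> J' \<Longrightarrow> p (q x) = x"
      by simp_all
    \<comment> \<open>The state and the kernel matrices for \<open>J'\<close> become one point of
      the product; \<open>q\<close> finds the position of a boundary point in the
      enumeration.\<close>
    define z where "z = case_sum (\<lambda>(k, a, b). if a < r \<and> b < r then T k $$ (a, b) else 0)
      (\<lambda>(x, i, a). if x \<in> J' \<and> i < fst x \<and> a < r then W (q x) $$ (i, a) else 0)"
    have TH: "T \<in> Her r" using T by (simp add: states_def)
    have TT: "TT z = T"
      by (intro ext eq_matI) (auto simp: TT_def z_def Her_dim[OF TH])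
    have WW: "WW z x = W (q x)" if "x \<in> J'" for x
      using W[OF q(1)[OF that]] that by (intro eq_matI) (auto simp: WW_def z_def q(2)[OF that])
    have "cmod (z x) \<le> bnd x" for x
    proof (cases x)
      case (Inl y)
      then show ?thesis using c[OF T]
        by (cases y) (simp add: z_def bnd_def le_max_iff_disj)
    next
      case (Inr y)
      obtain x' i a where y: "y = (x', i, a)" by (cases y)
      have "cmod (W (q x') $$ (i, a)) \<le> 1" if "x' \<in> J'" "i < fst x'" "a < r"
        using W[OF q(1)[OF that(1)]] q(2)[OF that(1)] that(2,3)
        by (intro norm_index_le_of_normsq[of "fst x'" r]) auto
      then show ?thesis by (simp add: Inr y z_def bnd_def)
    qed
    moreover have "z \<in> F x" if "x \<in> J" for x
    proof -
      have x: "x \<in> J'" using that by (simp add: J'_def)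
      show ?thesis
        using W[OF q(1)[OF x]] T by (simp add: F_def TT WW[OF x] q(2)[OF x])
    qed
    ultimately show ?thesis by blast
  qed
  have "?Z \<inter> (\<Inter>p\<in>I. F p) \<noteq> {}"
    using compact_coordinate_bounds closed_F fip by (rule compact_imp_fip_image)
  then obtain z where z: "\<And>p. p \<in> I \<Longrightarrow> z \<in> F p" by blast
  show ?thesis
  proof (rule that[of "TT z"])
    \<comment> \<open>Being a state is part of every \<open>F p\<close>, so one boundary point is
      enough to obtain it.\<close>
    show "TT z \<in> states r" using z[OF p0] by (simp add: F_def)
    show "\<exists>W\<in>carrier_mat s r. normsq s r W = 1 \<and> pairing r (TT z) (tcompress W A) = 0"
      if "s \<ge> 1" "A \<in> Her_top s frontier_of C s" for s A
      using z[of "(s, A)"] that by (intro bexI[of _ "WW z (s, A)"]) (auto simp: F_def I_def WW_def)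
  qed
qed

lemma realizable_of_common_state:
  assumes r: "r \<ge> 1" and T: "T \<in> states r"
    and sing: "\<And>s A. s \<ge> 1 \<Longrightarrow> A \<in> Her_top s frontier_of C s \<Longrightarrow>
      \<exists>W\<in>carrier_mat s r. normsq s r W = 1 \<and> pairing r T (tcompress W A) = 0"
  shows "realizable r C u"
proof -
  have TH: "T \<in> Her r" and one: "unital r u T" and nonneg: "\<And>X. X \<in> C r \<Longrightarrow> 0 \<le> Re (pairing r T X)"
    using T by (auto simp: states_def)
  have "A \<in> C s" if s: "s \<ge> 1" and A: "A \<in> Her s"
    and pos: "\<forall>V\<in>carrier_mat s r. 0 \<le> Re (pairing r T (tcompress V A))" for s A
  proof (rule ccontr)
    assume "A \<notin> C s"
    then obtain t where t: "t > 0" "tplus A (tscale t (unit s)) \<in> Her_top s frontier_of C s"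
      using exists_unit_translate_in_frontier[OF s A] by blast
    obtain W where W: "W \<in> carrier_mat s r" "normsq s r W = 1"
      "pairing r T (tcompress W (tplus A (tscale t (unit s)))) = 0"
      using sing[OF s t(2)] by blast
    \<comment> \<open>As \<open>W\<close> has norm 1, the summand \<open>tscale t (unit s)\<close>
      contributes exactly \<open>t\<close>.\<close>
    then have "pairing r T (tcompress W A) + of_real t = 0"
      using tcompress_linear[OF W(1) A utensor_one_Her[of u s], of t]
      by (simp add: pairing_tplus tscale_Her tcompress_Her[OF W(1)] A utensor_one_Her
          pairing_tscale[OF tcompress_Her[OF W(1) utensor_one_Her]] pairing_tcompress_unit[OF unitalD[OF one] W(1)])
    then have "Re (pairing r T (tcompress W A) + of_real t) = 0" by (simp only: zero_complex.sel)
    then have "Re (pairing r T (tcompress W A)) + t = 0" by simp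
    then show False using pos W(1) t(1) by force
  qed
  moreover have "0 \<le> Re (pairing r T (tcompress V A))" if "s \<ge> 1" "A \<in> C s" "V \<in> carrier_mat s r" for s A V
    using compress_closed[OF that(1) r that(2,3)] nonneg by blast
  ultimately show ?thesis
    unfolding realizable_iff using TH one by blast
qed

end

theorem theorem2p3:
  fixes C :: "nat \<Rightarrow> ('d::finite \<Rightarrow> complex mat) set"
    and u :: "'d \<Rightarrow> real"
    and r :: nat
  assumes "operator_system C u"
    and "r \<ge> 1"
  shows "realizable r C u \<longleftrightarrow>
    (\<forall>(n::nat) (s :: nat \<Rightarrow> nat) (A :: nat \<Rightarrow> 'd \<Rightarrow> complex mat).
       n \<ge> 1 \<longrightarrow>
       (\<forall>i<n. s i \<ge> 1 \<and> A i \<in> Her_top (s i) frontier_of C (s i)) \<longrightarrow>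
       (\<exists>V :: nat \<Rightarrow> complex mat.
          (\<forall>i<n. V i \<in> carrier_mat (s i) r \<and> V i \<noteq> 0\<^sub>m (s i) r) \<and>
          (\<lambda>k. msum r r (\<lambda>i. tcompress (V i) (A i) k) {..<n}) \<in> ess_boundary C u r))"
    (is "_ \<longleftrightarrow> ?compressions")
proof
  interpret operator_system C u by (rule assms(1))
  assume "realizable r C u"
  then obtain T where "T \<in> Her r" "unital r u T" and C_iff: "\<forall>s\<ge>1. \<forall>A\<in>Her s.
      A \<in> C s \<longleftrightarrow> (\<forall>V\<in>carrier_mat s r. 0 \<le> Re (pairing r T (tcompress V A)))"
    unfolding realizable_iff by blast
  then show ?compressions
    by (intro allI impI ess_boundary_of_realization[OF assms(2)]) auto
next
  interpret operator_system C u by (rule assms(1))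
  assume ?compressions
  then obtain T where "T \<in> states r"
    "\<And>s A. s \<ge> 1 \<Longrightarrow> A \<in> Her_top s frontier_of C s \<Longrightarrow>
      \<exists>W\<in>carrier_mat s r. normsq s r W = 1 \<and> pairing r T (tcompress W A) = 0"
    using exists_common_state[OF assms(2)] by blast
  then show "realizable r C u"
    by (rule realizable_of_common_state[OF assms(2)])
qed

end
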